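(* Let $(X,x)$ be a pointed cubical Kan complex. Then the group $\pi_n(X,x)$ is abelian for every $n\ge2$.
   Context: Cubes: $\square$ is the category whose objects are the posets $[1]^n=\{0\le 1\}^n$, $n\ge 0$, with morphisms generated under composition (inside posets) by the faces $\partial_{i,\varepsilon}\colon [1]^{n-1}\to[1]^n$ inserting $\varepsilon\in\{0,1\}$ as $i$-th coordinate, the degeneracies $\sigma_i\colon[1]^n\to[1]^{n-1}$ deleting the $i$-th coordinate, and the connections $\gamma_{i,0},\gamma_{i,1}\colon[1]^n\to[1]^{n-1}$ ($1\le i\le n-1$) replacing $x_i,x_{i+1}$ by their maximum, resp. minimum. A cubical set is a functor $\square^{op}\to\mathsf{Set}$; operators act on the right. $\square^n$ is the representable at $[1]^n$. The open box $\sqcap^n_{i,\varepsilon}\subseteq\square^n$ is the union of the images of all faces $\partial_{j,\eta}$ with $(j,\eta)\ne(i,\varepsilon)$. The geometric product $\otimes$ is the left Kan extension of $[1]^m\otimes[1]^n=[1]^{m+n}$, and $\hom_R(X,-)$ is the right adjoint of $X\otimes -$. A Kan complex is a cubical set $X$ such that every map $\sqcap^n_{i,\varepsilon}\to X$ extends to $\square^n\to X$. Cubical homotopy groups of a pointed Kan complex $(X,x)$: $\Omega(X,x)$ is the pullback of $(x,x)\colon\square^0\to X\times X$ along $(\partial_{1,0}^*,\partial_{1,1}^* )\colon\hom_R(\square^1,X)\to X\times X$, pointed at $x\sigma_1$ (so a $k$-cube of $\Omega(X,x)$ is a $(k+1)$-cube of $X$ whose $\partial_{1,0}$- and $\partial_{1,1}$-faces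 are degenerate at $x$); $\Omega^0(X,x)=(X,x)$ and $\Omega^n(X,x)=\Omega(\Omega^{n-1}(X,x))$. $\pi_0(X)$ is the colimit of $X\colon\square^{op}\to\mathsf{Set}$ and $\pi_n(X,x)=\pi_0(\Omega^n(X,x))$. Group structure on $\pi_1(X,x)$: for $1$-cubes $f,g$ with both end-points $x$, $[f][g]=[s\partial_{2,0}]$ for any $2$-cube $s$ with $s\partial_{1,0}=f$, $s\partial_{2,1}=g$, $s\partial_{1,1}=x\sigma_1$; for $n\ge1$, $\pi_n(X,x)=\pi_1(\Omega^{n-1}(X,x))$ carries the resulting group structure. *)

theory Defs
  imports "HOL-Algebra.Group"
begin

section \<open>The box category\<close>

text \<open>
  A vertex of the poset \<open>[1]\<^sup>n\<close> is a Boolean list of length \<open>n\<close>, with \<open>False\<close> and \<open>True\<close> in the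
  roles of 0 and 1. A map out of \<open>[1]\<^sup>m\<close> is a partial function defined on exactly the lists of
  length \<open>m\<close>. In this way equality of partial functions is equality of maps, source and target
  are determined by the partial function, and composition is \<open>\<circ>\<^sub>m\<close>.
\<close>

type_synonym box_map = "bool list \<rightharpoonup> bool list"

definition box_id :: "nat \<Rightarrow> box_map" where
  "box_id n = (\<lambda>v. if length v = n then Some v else None)"

text \<open>
  Coordinates are numbered from 1. In each case \<open>n\<close> is the larger of the two dimensions:
  \<open>\<partial>\<^bsub>i,\<epsilon>\<^esub> : [1]\<^bsup>n-1\<^esup> \<rightarrow> [1]\<^sup>n\<close>, while \<open>\<sigma>\<^sub>i\<close> and \<open>\<gamma>\<^bsub>i,\<epsilon>\<^esub>\<close> go \<open>[1]\<^sup>n \<rightarrow> [1]\<^bsup>n-1\<^esup>\<close>.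
  The maximum gives \<open>\<gamma>\<^bsub>i,0\<^esub>\<close>, the minimum \<open>\<gamma>\<^bsub>i,1\<^esub>\<close>.
\<close>

definition face :: "nat \<Rightarrow> nat \<Rightarrow> bool \<Rightarrow> box_map" where
  "face n i \<epsilon> = (\<lambda>v. if Suc (length v) = n
     then Some (take (i - 1) v @ [\<epsilon>] @ drop (i - 1) v) else None)"

definition degen :: "nat \<Rightarrow> nat \<Rightarrow> box_map" where
  "degen n i = (\<lambda>v. if length v = n
     then Some (take (i - 1) v @ drop i v) else None)"

definition conn :: "nat \<Rightarrow> nat \<Rightarrow> bool \<Rightarrow> box_map" where
  "conn n i \<epsilon> = (\<lambda>v. if length v = n
     then Some (take (i - 1) v
       @ [if \<epsilon> then v ! (i - 1) \<and> v ! i else v ! (i - 1) \<or> v ! i] @ drop (i + 1) v)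
     else None)"

inductive box_hom :: "nat \<Rightarrow> nat \<Rightarrow> box_map \<Rightarrow> bool" where
  box_hom_id: "box_hom n n (box_id n)"
| box_hom_face: "1 \<le> i \<Longrightarrow> i \<le> Suc n \<Longrightarrow> box_hom n (Suc n) (face (Suc n) i \<epsilon>)"
| box_hom_degen: "1 \<le> i \<Longrightarrow> i \<le> Suc n \<Longrightarrow> box_hom (Suc n) n (degen (Suc n) i)"
| box_hom_conn: "1 \<le> i \<Longrightarrow> i \<le> n \<Longrightarrow> box_hom (Suc n) n (conn (Suc n) i \<epsilon>)"
| box_hom_comp: "box_hom l m f \<Longrightarrow> box_hom m n g \<Longrightarrow> box_hom l n (g \<circ>\<^sub>m f)"

definition box_terminal :: "nat \<Rightarrow> box_map" where
  "box_terminal k = (\<lambda>v. if length v = k then Some [] else None)"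

text \<open>The geometric product \<open>[1] \<otimes> f\<close>, which keeps the new first coordinate.\<close>

definition box_shift :: "box_map \<Rightarrow> box_map" where
  "box_shift f = (\<lambda>v. case v of [] \<Rightarrow> None | b # w \<Rightarrow> map_option ((#) b) (f w))"


section \<open>Cubical sets and Kan complexes\<close>

text \<open>
  The cells of different dimensions are subsets of one common type and need not be disjoint.
  The value \<open>act X f c\<close> is the right action \<open>c f\<close>.
\<close>

record 'a cubical_data =
  cells :: "nat \<Rightarrow> 'a set"
  act :: "box_map \<Rightarrow> 'a \<Rightarrow> 'a"

locale cubical_set =
  fixes X :: "'a cubical_data"
  assumes act_closed: "box_hom m n f \<Longrightarrow> c \<in> cells X n \<Longrightarrow> act X f c \<in> cells X m"
    and act_id: "c \<in> cells X n \<Longrightarrow> act X (box_id n) c = c"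
    and act_comp: "box_hom l m f \<Longrightarrow> box_hom m n g \<Longrightarrow> c \<in> cells X n
      \<Longrightarrow> act X (g \<circ>\<^sub>m f) c = act X f (act X g c)"

definition cubical_map ::
  "'a cubical_data \<Rightarrow> 'b cubical_data \<Rightarrow> (nat \<Rightarrow> 'a \<Rightarrow> 'b) \<Rightarrow> bool" where
  "cubical_map Y X \<phi> \<longleftrightarrow>
     (\<forall>k. \<forall>c\<in>cells Y k. \<phi> k c \<in> cells X k) \<and>
     (\<forall>m n f. \<forall>c\<in>cells Y n. box_hom m n f \<longrightarrow> \<phi> m (act Y f c) = act X f (\<phi> n c))"

definition std_cube :: "nat \<Rightarrow> box_map cubical_data" where
  "std_cube n = \<lparr>cells = (\<lambda>k. {f. box_hom k n f}), act = (\<lambda>f c. c \<circ>\<^sub>m f)\<rparr>"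

definition open_box :: "nat \<Rightarrow> nat \<Rightarrow> bool \<Rightarrow> box_map cubical_data" where
  "open_box n i \<epsilon> = \<lparr>
     cells = (\<lambda>k. {face n j \<eta> \<circ>\<^sub>m g | j \<eta> g.
       1 \<le> j \<and> j \<le> n \<and> (j, \<eta>) \<noteq> (i, \<epsilon>) \<and> g \<in> cells (std_cube (n - 1)) k}),
     act = act (std_cube n)\<rparr>"

locale kan_complex = cubical_set X for X :: "'a cubical_data" +
  assumes filler: "1 \<le> i \<Longrightarrow> i \<le> n \<Longrightarrow> cubical_map (open_box n i \<epsilon>) X \<phi>
    \<Longrightarrow> \<exists>\<psi>. cubical_map (std_cube n) X \<psi> \<and>
            (\<forall>k. \<forall>c\<in>cells (open_box n i \<epsilon>) k. \<psi> k c = \<phi> k c)"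


section \<open>Loop spaces\<close>

text \<open>
  \<open>path_object X\<close> is \<open>hom\<^sub>R(\<box>\<^sup>1, X)\<close>. By adjunction and the Yoneda lemma its \<open>k\<close>-cubes are the maps
  \<open>\<box>\<^sup>1 \<otimes> \<box>\<^sup>k = \<box>\<^bsup>1+k\<^esup> \<rightarrow> X\<close>, that is, the \<open>(k+1)\<close>-cubes of \<open>X\<close>, and \<open>f\<close> acts through \<open>[1] \<otimes> f\<close>.
  Taking the cells in this form, rather than as natural transformations, keeps the cell type
  unchanged, so that the loop space construction can be iterated.
\<close>

definition path_object :: "'a cubical_data \<Rightarrow> 'a cubical_data" where
  "path_object X = \<lparr>cells = (\<lambda>k. cells X (Suc k)), act = (\<lambda>f. act X (box_shift f))\<rparr>"

text \<open>
  A pointed cubical set is a pair. The pullback condition on a \<open>k\<close>-cube says that its endpoints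
  under \<open>\<partial>\<^bsub>1,0\<^esub>\<^sup>*\<close> and \<open>\<partial>\<^bsub>1,1\<^esub>\<^sup>*\<close> are both the \<open>k\<close>-cube \<open>\<box>\<^sup>k \<rightarrow> \<box>\<^sup>0 \<rightarrow> X\<close> given by the base point.
\<close>

fun loops :: "'a cubical_data \<times> 'a \<Rightarrow> 'a cubical_data \<times> 'a" where
  "loops (X, x) =
     (\<lparr>cells = (\<lambda>k. {c \<in> cells (path_object X) k.
          \<forall>\<epsilon>. act X (face (Suc k) 1 \<epsilon>) c = act X (box_terminal k) x}),
       act = act (path_object X)\<rparr>,
      act X (degen 1 1) x)"


section \<open>Homotopy groups\<close>

text \<open>
  The colimit of \<open>X\<close> is the disjoint union of all its sets of cells modulo the equivalence
  relation generated by \<open>c \<sim> c f\<close>.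
\<close>

definition colim_step :: "'a cubical_data \<Rightarrow> ((nat \<times> 'a) \<times> (nat \<times> 'a)) set" where
  "colim_step X = {((n, c), (m, act X f c)) | m n f c. box_hom m n f \<and> c \<in> cells X n}"

definition colim_rel :: "'a cubical_data \<Rightarrow> ((nat \<times> 'a) \<times> (nat \<times> 'a)) set" where
  "colim_rel X = (colim_step X \<union> (colim_step X)\<inverse>)\<^sup>*"

definition pi0 :: "'a cubical_data \<Rightarrow> (nat \<times> 'a) set set" where
  "pi0 X = (SIGMA n:UNIV. cells X n) // colim_rel X"

definition pi0_class :: "'a cubical_data \<Rightarrow> 'a \<Rightarrow> (nat \<times> 'a) set" where
  "pi0_class X c = colim_rel X `` {(0, c)}"

definition homotopy_set :: "nat \<Rightarrow> 'a cubical_data \<times> 'a \<Rightarrow> (nat \<times> 'a) set set" where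
  "homotopy_set n P = pi0 (fst ((loops ^^ n) P))"

text \<open>
  The 0-cubes of \<open>fst (loops (X, x))\<close> are the 1-cubes of \<open>X\<close> with both endpoints \<open>x\<close>. The definite
  description below picks out a meaningful class exactly if a suitable 2-cube \<open>s\<close> exists and the
  class of its remaining face depends neither on \<open>s\<close> nor on the representatives \<open>f\<close> and \<open>g\<close>.
\<close>

fun pi1_mult :: "'a cubical_data \<times> 'a \<Rightarrow> (nat \<times> 'a) set \<Rightarrow> (nat \<times> 'a) set \<Rightarrow> (nat \<times> 'a) set" where
  "pi1_mult (X, x) a b = (let L = fst (loops (X, x)) in
     THE c. \<exists>f\<in>cells L 0. \<exists>g\<in>cells L 0. \<exists>s\<in>cells X 2.
       a = pi0_class L f \<and> b = pi0_class L g \<and>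
       act X (face 2 1 False) s = f \<and>
       act X (face 2 2 True) s = g \<and>
       act X (face 2 1 True) s = act X (degen 1 1) x \<and>
       c = pi0_class L (act X (face 2 2 False) s))"

definition fundamental_group :: "'a cubical_data \<times> 'a \<Rightarrow> (nat \<times> 'a) set monoid" where
  "fundamental_group P = \<lparr>carrier = homotopy_set 1 P, mult = pi1_mult P,
     one = pi0_class (fst (loops P)) (snd (loops P))\<rparr>"

text \<open>Meant for \<open>n \<ge> 1\<close> only.\<close>

definition homotopy_group :: "nat \<Rightarrow> 'a cubical_data \<times> 'a \<Rightarrow> (nat \<times> 'a) set monoid" where
  "homotopy_group n P = fundamental_group ((loops ^^ (n - 1)) P)"

lemma carrier_homotopy_group:
  assumes "n \<ge> 1"
  shows "carrier (homotopy_group n P) = homotopy_set n P"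
  using assms by (cases n) (simp_all add: homotopy_group_def fundamental_group_def homotopy_set_def)

end

theory Submission
  imports Defs
begin

text \<open>
  The loops of \<open>\<Omega>(X, x)\<close> are the 2-cubes of \<open>X\<close> with constant boundary. They can be concatenated in
  both directions: along the second coordinate, which is the product of \<open>\<pi>\<^sub>1(\<Omega>(X, x))\<close>, and along the
  first. Filling an open 4-box gives the interchange law between the two operations, and degeneracies
  and connections show that the constant loop is a unit for both, so they agree and are commutative
  (Eckmann-Hilton). Since \<open>\<Omega>(X, x)\<close> is again a Kan complex, this covers all \<open>n \<ge> 2\<close>.
\<close>

section \<open>The box category\<close>

text \<open>The definitions give little to compute with: a filler is asked for a cubical map on an
  open box, \<open>pi0\<close> is the quotient by a generated relation, and the product is a
  definite description. Everything is therefore reduced to the existence of cubes with given faces.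
  The main filling arguments have one form: assign a cube to each codimension-2 face, exhibit all
  facets but one with the resulting boundaries, and read off the missing facet. A 3-cube gives
  well-definedness and associativity of the product, a 4-cube gives interchange. The unit laws hold
  at the level of cubes: for the constant loop \<open>e\<close>, degeneracies witness that
  \<open>e\<close> followed by \<open>a\<close> is \<open>a\<close>, and connections that
  \<open>a\<close> followed by \<open>e\<close> is \<open>a\<close>. So if \<open>w\<close> is a
  composite of \<open>f\<close> and \<open>g\<close> in the first direction, the arrays with rows
  \<open>f e\<close>, \<open>e g\<close> and with rows \<open>e g\<close>, \<open>f e\<close> both
  have \<open>w\<close> as total composite. One and the same cube \<open>w\<close> represents both
  products, and no homotopies are needed in the Eckmann-Hilton step.\<close>

lemma box_hom_length:
  assumes "box_hom m n f"
  shows "length v \<noteq> m \<Longrightarrow> f v = None" and "length v = m \<Longrightarrow> \<exists>w. f v = Some w \<and> length w = n"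
  using assms
proof (induction arbitrary: v rule: box_hom.induct)
  case (box_hom_comp l m f n g)
  { case 1 then show ?case using box_hom_comp.IH(1) by simp }
  { case 2
    then obtain w where "f v = Some w" "length w = m" using box_hom_comp.IH(2) by blast
    then show ?case using box_hom_comp.IH(4) by simp }
qed (auto simp: box_id_def face_def degen_def conn_def)

lemma box_map_eqI:
  assumes f: "box_hom m n f" and g: "box_hom m n' g" and eq: "\<And>v. length v = m \<Longrightarrow> f v = g v"
  shows "f = g"
proof
  fix v show "f v = g v"
    using eq box_hom_length(1)[OF f] box_hom_length(1)[OF g] by (cases "length v = m") simp_all
qed

lemma box_hom_comp_id [simp]:
  assumes f: "box_hom m n f"
  shows "box_id n \<circ>\<^sub>m f = f" and "f \<circ>\<^sub>m box_id m = f"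
proof -
  show "box_id n \<circ>\<^sub>m f = f"
  proof (rule box_map_eqI[OF box_hom_comp[OF f box_hom_id] f])
    fix v :: "bool list" assume "length v = m"
    then obtain w where "f v = Some w" "length w = n" using box_hom_length(2)[OF f] by blast
    then show "(box_id n \<circ>\<^sub>m f) v = f v" by (simp add: box_id_def)
  qed
  show "f \<circ>\<^sub>m box_id m = f"
    by (rule box_map_eqI[OF box_hom_comp[OF box_hom_id f] f]) (simp add: box_id_def)
qed

lemma face_eq: "length v = n \<Longrightarrow> face (Suc n) i \<epsilon> v = Some (take (i - 1) v @ \<epsilon> # drop (i - 1) v)"
  by (simp add: face_def)

lemma map_comp_assoc: "h \<circ>\<^sub>m (g \<circ>\<^sub>m f) = (h \<circ>\<^sub>m g) \<circ>\<^sub>m f"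
  by (auto simp: map_comp_def fun_eq_iff split: option.splits)

lemma box_hom_terminal: "box_hom n 0 (box_terminal n)"
proof (induction n)
  case 0
  have "box_terminal 0 = box_id 0" by (auto simp: box_terminal_def box_id_def)
  then show ?case by (simp add: box_hom_id)
next
  case (Suc n)
  have "box_terminal (Suc n) = box_terminal n \<circ>\<^sub>m degen (Suc n) 1"
    by (auto simp: fun_eq_iff box_terminal_def degen_def map_comp_def)
  then show ?case
    using box_hom_comp[OF box_hom_degen[of 1 n] Suc] by simp
qed

lemma box_terminal_unique: "box_hom n 0 f \<Longrightarrow> f = box_terminal n"
  by (rule box_map_eqI[OF _ box_hom_terminal]) (auto dest: box_hom_length simp: box_terminal_def)

lemma box_terminal_comp: "box_hom m n f \<Longrightarrow> box_terminal n \<circ>\<^sub>m f = box_terminal m"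
  by (rule box_terminal_unique[OF box_hom_comp[OF _ box_hom_terminal]])

lemma ex_vertex: "\<exists>v. box_hom 0 n v"
proof (induction n)
  case 0 show ?case using box_hom_id by blast
next
  case (Suc n)
  then obtain v where "box_hom 0 n v" by blast
  then have "box_hom 0 (Suc n) (face (Suc n) 1 False \<circ>\<^sub>m v)"
    by (rule box_hom_comp) (rule box_hom_face; simp)
  then show ?case by blast
qed

section \<open>Face identities and intersections of faces\<close>

lemma face_comp_face:
  assumes "1 \<le> j" "j < k" "k \<le> Suc (Suc n)"
  shows "face (Suc (Suc n)) j \<eta> \<circ>\<^sub>m face (Suc n) (k - 1) \<theta>
       = face (Suc (Suc n)) k \<theta> \<circ>\<^sub>m face (Suc n) j \<eta>"
proof (rule box_map_eqI)
  fix v :: "bool list" assume v: "length v = n"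
  obtain a b where [simp]: "j = Suc a" "k = Suc (Suc (a + b))"
    using assms by (metis Suc_le_D less_imp_Suc_add One_nat_def add_Suc)
  have "take (a + b) v = take a v @ take b (drop a v)" by (simp add: take_add)
  then show "(face (Suc (Suc n)) j \<eta> \<circ>\<^sub>m face (Suc n) (k - 1) \<theta>) v
      = (face (Suc (Suc n)) k \<theta> \<circ>\<^sub>m face (Suc n) j \<eta>) v"
    using v assms by (simp add: map_comp_def face_def min_def add.commute) arith
qed (use assms in \<open>auto intro!: box_hom_comp box_hom_face\<close>)

lemma degen_comp_face:
  assumes "1 \<le> i" "i \<le> Suc n"
  shows "degen (Suc n) i \<circ>\<^sub>m face (Suc n) i \<epsilon> = box_id n"
proof (rule box_map_eqI)
  fix v :: "bool list" assume v: "length v = n"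
  obtain a where "i = Suc a" using assms by (cases i) auto
  then show "(degen (Suc n) i \<circ>\<^sub>m face (Suc n) i \<epsilon>) v = box_id n v"
    using v assms by (simp add: map_comp_def face_eq degen_def box_id_def min_def)
qed (use assms in \<open>auto intro!: box_hom_comp box_hom_face box_hom_degen box_hom_id\<close>)

lemma face_nth:
  assumes "1 \<le> i" "i \<le> Suc n" "face (Suc n) i \<epsilon> v = Some w"
  shows "w ! (i - 1) = \<epsilon>"
proof -
  have "length v = n" using assms(3) by (auto simp: face_def split: if_splits)
  then show ?thesis using assms by (auto simp: face_eq nth_append)
qed

text \<open>\<open>box_hom\<close> is generated inductively, so the factor must itself be built from
  generators. Composing with the retraction \<open>degen (Suc n) i\<close> of the face does
  this.\<close>

lemma factor_face:
  assumes "box_hom m (Suc n) f" "1 \<le> i" "i \<le> Suc n"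
    and "\<And>v w. f v = Some w \<Longrightarrow> w ! (i - 1) = \<epsilon>"
  shows "f = face (Suc n) i \<epsilon> \<circ>\<^sub>m (degen (Suc n) i \<circ>\<^sub>m f)"
proof (rule box_map_eqI)
  fix v :: "bool list" assume "length v = m"
  then obtain w where w: "f v = Some w" "length w = Suc n"
    using box_hom_length assms(1) by blast
  obtain a where a: "i = Suc a" using assms by (cases i) auto
  have "w ! a = \<epsilon>" using assms(4) w a by force
  then have "take a w @ \<epsilon> # drop (Suc a) w = w"
    using id_take_nth_drop[of a w, symmetric] assms(3) w a by simp
  then show "f v = (face (Suc n) i \<epsilon> \<circ>\<^sub>m (degen (Suc n) i \<circ>\<^sub>m f)) v"
    using w assms(3) a by (simp add: map_comp_def degen_def face_def min_def)
next
  show "box_hom m (Suc n) f" by (rule assms(1))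
  show "box_hom m (Suc n) (face (Suc n) i \<epsilon> \<circ>\<^sub>m (degen (Suc n) i \<circ>\<^sub>m f))"
    using assms(2,3) by (intro box_hom_comp[OF box_hom_comp[OF assms(1) box_hom_degen] box_hom_face])
qed

text \<open>The degeneracy in the same direction retracts a face, so faces are monic; coordinate
  \<open>i\<close> of any vertex in the image tells opposite faces apart.\<close>

lemma face_cancel:
  assumes g: "box_hom m n g" and g': "box_hom m n g'" and i: "1 \<le> i" "i \<le> Suc n"
    and eq: "face (Suc n) i \<epsilon> \<circ>\<^sub>m g = face (Suc n) i \<epsilon>' \<circ>\<^sub>m g'"
  shows "\<epsilon> = \<epsilon>'" and "g = g'"
proof -
  have l: "length (replicate m False) = m" by simp
  obtain w where w: "g (replicate m False) = Some w" "length w = n"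
    using box_hom_length(2)[OF g l] by blast
  obtain w' where w': "g' (replicate m False) = Some w'" "length w' = n"
    using box_hom_length(2)[OF g' l] by blast
  have fw: "face (Suc n) i \<epsilon>' w' = face (Suc n) i \<epsilon> w"
    using fun_cong[OF eq, of "replicate m False"] w w' by simp
  note nth = face_nth[OF i face_eq[OF w(2)]]
  show "\<epsilon> = \<epsilon>'"
    using nth face_nth[OF i trans[OF fw face_eq[OF w(2)]]] by (rule trans[OF sym])
  have *: "degen (Suc n) i \<circ>\<^sub>m (face (Suc n) i \<epsilon> \<circ>\<^sub>m f) = f" if "box_hom m n f" for f \<epsilon>
    unfolding map_comp_assoc degen_comp_face[OF i] by (rule box_hom_comp_id(1)[OF that])
  have "g = degen (Suc n) i \<circ>\<^sub>m (face (Suc n) i \<epsilon> \<circ>\<^sub>m g)" by (rule *[OF g, symmetric])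
  also have "\<dots> = g'" unfolding eq by (rule *[OF g'])
  finally show "g = g'" .
qed

text \<open>Facets in different directions meet in a codimension-2 face, and they do so as a
  pullback in the box category. This is what makes maps out of an open box well defined.\<close>

lemma face_pullback:
  assumes g: "box_hom m (Suc n) g" and h: "box_hom m (Suc n) h"
    and jk: "1 \<le> j" "j < k" "k \<le> Suc (Suc n)"
    and eq: "face (Suc (Suc n)) j \<eta> \<circ>\<^sub>m g = face (Suc (Suc n)) k \<theta> \<circ>\<^sub>m h"
  obtains u where "box_hom m n u" "g = face (Suc n) (k - 1) \<theta> \<circ>\<^sub>m u" "h = face (Suc n) j \<eta> \<circ>\<^sub>m u"
proof -
  have k: "1 \<le> k - 1" "k - 1 \<le> Suc n" "1 \<le> k" "j \<le> Suc n" using jk by auto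
  define u where "u = degen (Suc n) (k - 1) \<circ>\<^sub>m g"
  have u: "box_hom m n u" unfolding u_def by (rule box_hom_comp[OF g box_hom_degen[OF k(1,2)]])
  have fu: "box_hom m (Suc n) (face (Suc n) j \<eta> \<circ>\<^sub>m u)"
    by (rule box_hom_comp[OF u box_hom_face[OF jk(1) k(4)]])
  \<comment> \<open>Inserting a coordinate at \<open>j < k\<close> pushes position
    \<open>k - 1\<close> to \<open>k\<close>, where the equation \<open>eq\<close> forces the
    value.\<close>
  have "w ! (k - 1 - 1) = \<theta>" if gvw: "g v = Some w" for v w
  proof -
    have v: "length v = m" using box_hom_length(1)[OF g, of v] gvw by (cases "length v = m") simp_all
    have lw: "length w = Suc n" using box_hom_length(2)[OF g v] gvw by simp
    obtain w' where w': "h v = Some w'" "length w' = Suc n" using box_hom_length(2)[OF h v] by blast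
    have "face (Suc (Suc n)) k \<theta> w' = Some (take (j - 1) w @ \<eta> # drop (j - 1) w)"
      using fun_cong[OF eq, of v] gvw w' face_eq[OF lw] by simp
    from face_nth[OF k(3) jk(3) this]
    moreover obtain a where "j = Suc a" using jk(1) by (cases j) simp_all
    moreover obtain b where "k = Suc (j + b)" using less_imp_Suc_add[OF jk(2)] by blast
    ultimately show "w ! (k - 1 - 1) = \<theta>" using lw jk(3) by (simp add: nth_append)
  qed
  then have gu: "g = face (Suc n) (k - 1) \<theta> \<circ>\<^sub>m u"
    unfolding u_def by (rule factor_face[OF g k(1,2)])
  have "face (Suc (Suc n)) k \<theta> \<circ>\<^sub>m h = face (Suc (Suc n)) j \<eta> \<circ>\<^sub>m g" by (rule eq[symmetric])
  also have "\<dots> = (face (Suc (Suc n)) j \<eta> \<circ>\<^sub>m face (Suc n) (k - 1) \<theta>) \<circ>\<^sub>m u"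
    by (subst gu) (rule map_comp_assoc)
  also have "\<dots> = face (Suc (Suc n)) k \<theta> \<circ>\<^sub>m (face (Suc n) j \<eta> \<circ>\<^sub>m u)"
    unfolding face_comp_face[OF jk] by (rule map_comp_assoc[symmetric])
  finally have "h = face (Suc n) j \<eta> \<circ>\<^sub>m u" by (rule face_cancel(2)[OF h fu k(3) jk(3)])
  with u gu show thesis by (rule that)
qed


section \<open>Shifted box maps\<close>

lemma box_shift_id: "box_shift (box_id n) = box_id (Suc n)"
  by (auto simp: box_shift_def box_id_def fun_eq_iff split: list.splits)

lemma box_shift_comp: "box_shift (g \<circ>\<^sub>m f) = box_shift g \<circ>\<^sub>m box_shift f"
  by (auto simp: box_shift_def map_comp_def fun_eq_iff split: list.splits option.splits)

lemma box_shift_face: "1 \<le> i \<Longrightarrow> box_shift (face (Suc n) i \<epsilon>) = face (Suc (Suc n)) (Suc i) \<epsilon>"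
  by (cases i) (auto simp: box_shift_def face_def fun_eq_iff split: list.splits)

lemma box_shift_degen: "1 \<le> i \<Longrightarrow> box_shift (degen n i) = degen (Suc n) (Suc i)"
  by (cases i) (auto simp: box_shift_def degen_def fun_eq_iff split: list.splits)

lemma box_shift_conn: "1 \<le> i \<Longrightarrow> box_shift (conn n i \<epsilon>) = conn (Suc n) (Suc i) \<epsilon>"
  by (cases i) (auto simp: box_shift_def conn_def fun_eq_iff split: list.splits)

lemma box_hom_shift: "box_hom m n f \<Longrightarrow> box_hom (Suc m) (Suc n) (box_shift f)"
  by (induction rule: box_hom.induct)
    (simp_all add: box_shift_id box_shift_face box_shift_degen box_shift_conn box_shift_comp
      box_hom.intros)

text \<open>Naturality of the inclusion of an end of the interval. It makes the loop condition
  stable under the action and identifies the end-points of the edges used for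
  \<open>pi0\<close>.\<close>

lemma box_shift_comp_face:
  assumes "box_hom m n f"
  shows "box_shift f \<circ>\<^sub>m face (Suc m) 1 \<epsilon> = face (Suc n) 1 \<epsilon> \<circ>\<^sub>m f"
proof (rule box_map_eqI)
  fix v :: "bool list" assume v: "length v = m"
  then obtain w where "f v = Some w" "length w = n" using box_hom_length(2)[OF assms] by blast
  with v show "(box_shift f \<circ>\<^sub>m face (Suc m) 1 \<epsilon>) v = (face (Suc n) 1 \<epsilon> \<circ>\<^sub>m f) v"
    by (simp add: map_comp_def face_eq box_shift_def)
qed (use assms in \<open>auto intro!: box_hom_comp box_hom_face box_hom_shift\<close>)


section \<open>Filling open boxes\<close>

context cubical_set
begin

lemma act_face_closed:
  "1 \<le> i \<Longrightarrow> i \<le> Suc n \<Longrightarrow> c \<in> cells X (Suc n) \<Longrightarrow> act X (face (Suc n) i \<epsilon>) c \<in> cells X n"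
  by (rule act_closed[OF box_hom_face])

lemma act_face_face:
  assumes "1 \<le> j" "j < k" "k \<le> Suc (Suc n)" "c \<in> cells X (Suc (Suc n))"
  shows "act X (face (Suc n) (k - 1) \<theta>) (act X (face (Suc (Suc n)) j \<eta>) c)
       = act X (face (Suc n) j \<eta>) (act X (face (Suc (Suc n)) k \<theta>) c)"
proof -
  have "box_hom n (Suc n) (face (Suc n) (k - 1) \<theta>)" "box_hom n (Suc n) (face (Suc n) j \<eta>)"
    "box_hom (Suc n) (Suc (Suc n)) (face (Suc (Suc n)) j \<eta>)"
    "box_hom (Suc n) (Suc (Suc n)) (face (Suc (Suc n)) k \<theta>)"
    using assms by (auto intro: box_hom_face)
  then show ?thesis
    using face_comp_face[OF assms(1-3), of \<eta> \<theta>] assms(4) by (simp flip: act_comp)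
qed

text \<open>The Yoneda correspondence, in the direction that turns a filling cube into a filling
  map.\<close>

lemma cubical_map_of_cell:
  assumes "y \<in> cells X n"
  shows "cubical_map (std_cube n) X (\<lambda>k f. act X f y)"
  using assms by (auto simp: cubical_map_def std_cube_def act_closed act_comp)

end

text \<open>An open box in \<open>X\<close> as a compatible family of cubes, one for each face but the missing one.\<close>

definition box_family where
  "box_family X n i \<epsilon> c \<longleftrightarrow>
     (\<forall>j \<eta>. 1 \<le> j \<longrightarrow> j \<le> Suc n \<longrightarrow> (j, \<eta>) \<noteq> (i, \<epsilon>) \<longrightarrow> c j \<eta> \<in> cells X n) \<and>
     (\<forall>j k \<eta> \<theta>. 1 \<le> j \<longrightarrow> j < k \<longrightarrow> k \<le> Suc n \<longrightarrow> (j, \<eta>) \<noteq> (i, \<epsilon>) \<longrightarrow> (k, \<theta>) \<noteq> (i, \<epsilon>) \<longrightarrow>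
        act X (face n (k - 1) \<theta>) (c j \<eta>) = act X (face n j \<eta>) (c k \<theta>))"

text \<open>The family extends to a map on the open box by sending \<open>g\<close> followed by
  facet \<open>(j, \<eta>)\<close> to \<open>c j \<eta>\<close> acted on by \<open>g\<close>. The
  cube \<open>y\<close> is the value of a filling map at the identity.\<close>

lemma (in kan_complex) box_filling:
  assumes i: "1 \<le> i" "i \<le> Suc n" and c: "box_family X n i \<epsilon> c"
  obtains y where "y \<in> cells X (Suc n)"
    "\<And>j \<eta>. 1 \<le> j \<Longrightarrow> j \<le> Suc n \<Longrightarrow> (j, \<eta>) \<noteq> (i, \<epsilon>) \<Longrightarrow> act X (face (Suc n) j \<eta>) y = c j \<eta>"
proof -
  let ?ok = "\<lambda>j \<eta>. 1 \<le> j \<and> j \<le> Suc n \<and> (j, \<eta>) \<noteq> (i, \<epsilon>)"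
  have c1: "c j \<eta> \<in> cells X n" if "?ok j \<eta>" for j \<eta>
    using c that unfolding box_family_def by blast
  have c2: "act X (face n (k - 1) \<theta>) (c j \<eta>) = act X (face n j \<eta>) (c k \<theta>)"
    if "?ok j \<eta>" "?ok k \<theta>" "j < k" for j k \<eta> \<theta>
    using c that unfolding box_family_def by blast
  have lt: "act X g (c j \<eta>) = act X h (c k \<theta>)"
    if A: "?ok j \<eta>" "?ok k \<theta>" "box_hom m n g" "box_hom m n h" "j < k"
      "face (Suc n) j \<eta> \<circ>\<^sub>m g = face (Suc n) k \<theta> \<circ>\<^sub>m h" for j k \<eta> \<theta> m g h
  proof -
    \<comment> \<open>Two different directions are present, so the cube has codimension-2 faces and
      \<open>face_pullback\<close> applies.\<close>
    obtain n' where n': "n = Suc n'" using A by (cases n) auto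
    obtain u where u: "box_hom m n' u" "g = face n (k - 1) \<theta> \<circ>\<^sub>m u" "h = face n j \<eta> \<circ>\<^sub>m u"
      using face_pullback[of m n' g h j k \<eta> \<theta>] A n' by blast
    have "box_hom n' n (face n (k - 1) \<theta>)" "box_hom n' n (face n j \<eta>)"
      using that n' by (auto intro!: box_hom_face)
    then show ?thesis using u c1[of j \<eta>] c1[of k \<theta>] c2[of j \<eta> k \<theta>] that by (simp add: act_comp)
  qed
  have wd: "act X g (c j \<eta>) = act X h (c k \<theta>)"
    if "?ok j \<eta>" "?ok k \<theta>" "box_hom m n g" "box_hom m n h"
      "face (Suc n) j \<eta> \<circ>\<^sub>m g = face (Suc n) k \<theta> \<circ>\<^sub>m h" for j k \<eta> \<theta> m g h
  proof (cases j k rule: linorder_cases)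
    case less then show ?thesis using lt that by blast
  next
    case equal
    then have "\<eta> = \<theta>" "g = h" using face_cancel[of m n g h k \<eta> \<theta>] that by auto
    then show ?thesis using equal by simp
  next
    case greater then show ?thesis using lt[of k \<theta> j \<eta> m h g] that by simp
  qed
  \<comment> \<open>A cell of the open box may lie on several facets; \<open>wd\<close> shows that
    the chosen factorization does not matter.\<close>
  define \<phi> where "\<phi> k f = (SOME z. \<exists>j \<eta> g. ?ok j \<eta> \<and> box_hom k n g \<and>
      f = face (Suc n) j \<eta> \<circ>\<^sub>m g \<and> z = act X g (c j \<eta>))" for k f
  have \<phi>: "\<phi> k (face (Suc n) j \<eta> \<circ>\<^sub>m g) = act X g (c j \<eta>)"
    if ok: "?ok j \<eta>" and g: "box_hom k n g" for k j \<eta> g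
  proof -
    have "\<exists>z j' \<eta>' g'. ?ok j' \<eta>' \<and> box_hom k n g' \<and>
        face (Suc n) j \<eta> \<circ>\<^sub>m g = face (Suc n) j' \<eta>' \<circ>\<^sub>m g' \<and> z = act X g' (c j' \<eta>')"
      using ok g by blast
    from someI_ex[OF this] obtain j' \<eta>' g' where ok': "?ok j' \<eta>'" and g': "box_hom k n g'"
      and eq: "face (Suc n) j \<eta> \<circ>\<^sub>m g = face (Suc n) j' \<eta>' \<circ>\<^sub>m g'"
      and \<phi>: "\<phi> k (face (Suc n) j \<eta> \<circ>\<^sub>m g) = act X g' (c j' \<eta>')"
      unfolding \<phi>_def by blast
    show ?thesis using \<phi> wd[OF ok ok' g g' eq] by (rule trans[OF _ sym])
  qed
  have box: "cells (open_box (Suc n) i \<epsilon>) k = {face (Suc n) j \<eta> \<circ>\<^sub>m g | j \<eta> g. ?ok j \<eta> \<and> box_hom k n g}" for k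
    by (simp add: open_box_def std_cube_def)
  have "cubical_map (open_box (Suc n) i \<epsilon>) X \<phi>"
    unfolding cubical_map_def box
  proof (intro conjI allI ballI impI; elim CollectE exE conjE; hypsubst)
    fix k j \<eta> g assume "(j, \<eta>) \<noteq> (i, \<epsilon>)" "1 \<le> j" "j \<le> Suc n" "box_hom k n g"
    then show "\<phi> k (face (Suc n) j \<eta> \<circ>\<^sub>m g) \<in> cells X k" using \<phi> c1 act_closed by simp
  next
    fix l k f j \<eta> g
    assume *: "1 \<le> j" "j \<le> Suc n" "(j, \<eta>) \<noteq> (i, \<epsilon>)" "box_hom k n g" "box_hom l k f"
    then have "\<phi> l (face (Suc n) j \<eta> \<circ>\<^sub>m (g \<circ>\<^sub>m f)) = act X f (act X g (c j \<eta>))"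
      using \<phi>[of j \<eta> l "g \<circ>\<^sub>m f"] c1 by (simp add: act_comp box_hom_comp)
    with * show "\<phi> l (act (open_box (Suc n) i \<epsilon>) f (face (Suc n) j \<eta> \<circ>\<^sub>m g))
        = act X f (\<phi> k (face (Suc n) j \<eta> \<circ>\<^sub>m g))"
      using \<phi> by (simp add: open_box_def std_cube_def map_comp_assoc)
  qed
  then obtain \<psi> where \<psi>: "cubical_map (std_cube (Suc n)) X \<psi>"
    "\<And>k f. f \<in> cells (open_box (Suc n) i \<epsilon>) k \<Longrightarrow> \<psi> k f = \<phi> k f"
    using filler[OF i] by blast
  show ?thesis
  proof
    show "\<psi> (Suc n) (box_id (Suc n)) \<in> cells X (Suc n)"
      using \<psi>(1) by (simp add: cubical_map_def std_cube_def box_hom_id)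
    fix j \<eta> assume j: "1 \<le> j" "j \<le> Suc n" "(j, \<eta>) \<noteq> (i, \<epsilon>)"
    then have f: "box_hom n (Suc n) (face (Suc n) j \<eta>)" by (simp add: box_hom_face)
    have "box_id (Suc n) \<in> cells (std_cube (Suc n)) (Suc n)"
      by (simp add: std_cube_def box_hom_id)
    then have "\<psi> n (act (std_cube (Suc n)) (face (Suc n) j \<eta>) (box_id (Suc n)))
        = act X (face (Suc n) j \<eta>) (\<psi> (Suc n) (box_id (Suc n)))"
      using \<psi>(1) f unfolding cubical_map_def by blast
    then have "act X (face (Suc n) j \<eta>) (\<psi> (Suc n) (box_id (Suc n)))
        = \<psi> n (box_id (Suc n) \<circ>\<^sub>m face (Suc n) j \<eta>)"
      by (simp add: std_cube_def)
    \<comment> \<open>This is the form in which the cells of \<open>open_box\<close> are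
      given.\<close>
    also have "\<dots> = \<psi> n (face (Suc n) j \<eta> \<circ>\<^sub>m box_id n)" using f by simp
    also have "\<dots> = \<phi> n (face (Suc n) j \<eta> \<circ>\<^sub>m box_id n)"
      using \<psi>(2)[of "face (Suc n) j \<eta> \<circ>\<^sub>m box_id n" n] j box_hom_id unfolding box by blast
    also have "\<dots> = c j \<eta>" using \<phi>[of j \<eta> n "box_id n"] j c1 by (simp add: box_hom_id act_id)
    finally show "act X (face (Suc n) j \<eta>) (\<psi> (Suc n) (box_id (Suc n))) = c j \<eta>" .
  qed
qed


text \<open>Prescribes the boundary of the cube in position \<open>(j, \<eta>)\<close> of a larger cube: \<open>F j k \<eta> \<theta>\<close>, for
  \<open>j < k\<close>, is the common face of codimension 2 where \<open>x\<^sub>j = \<eta>\<close> and \<open>x\<^sub>k = \<theta>\<close>.\<close>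

definition has_boundary ::
  "'a cubical_data \<Rightarrow> nat \<Rightarrow> (nat \<Rightarrow> nat \<Rightarrow> bool \<Rightarrow> bool \<Rightarrow> 'a) \<Rightarrow> nat \<Rightarrow> bool \<Rightarrow> 'a \<Rightarrow> bool" where
  "has_boundary X n F j \<eta> y \<longleftrightarrow> y \<in> cells X n \<and> (\<forall>k\<in>{1..n}. \<forall>\<theta>.
     act X (face n k \<theta>) y = (if k < j then F k j \<theta> \<eta> else F j (Suc k) \<eta> \<theta>))"

text \<open>Facets with these boundaries agree on overlaps, because \<open>F\<close> has only one
  value for each codimension-2 face. Each such face of the missing facet also lies on a given facet,
  which fixes the boundary of the missing one.\<close>

lemma (in kan_complex) missing_face:
  assumes i: "1 \<le> i" "i \<le> Suc (Suc n)"
    and F: "\<And>j \<eta>. 1 \<le> j \<Longrightarrow> j \<le> Suc (Suc n) \<Longrightarrow> (j, \<eta>) \<noteq> (i, \<epsilon>) \<Longrightarrow> \<exists>y. has_boundary X (Suc n) F j \<eta> y"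
  shows "\<exists>y. has_boundary X (Suc n) F i \<epsilon> y"
proof -
  define c where "c j \<eta> = (SOME y. has_boundary X (Suc n) F j \<eta> y)" for j \<eta>
  have c: "has_boundary X (Suc n) F j \<eta> (c j \<eta>)"
    if "1 \<le> j" "j \<le> Suc (Suc n)" "(j, \<eta>) \<noteq> (i, \<epsilon>)" for j \<eta>
    unfolding c_def using F[OF that] by (rule someI_ex)
  have c_low: "act X (face (Suc n) k \<theta>) (c j \<eta>) = F k j \<theta> \<eta>"
    if "1 \<le> j" "j \<le> Suc (Suc n)" "(j, \<eta>) \<noteq> (i, \<epsilon>)" "1 \<le> k" "k < j" for j \<eta> k \<theta>
    using c[OF that(1-3)] that(2,4,5) unfolding has_boundary_def by simp
  \<comment> \<open>Inside the facet in direction \<open>j\<close>, the later direction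
    \<open>k\<close> is numbered \<open>k - 1\<close>.\<close>
  have c_high: "act X (face (Suc n) (k - 1) \<theta>) (c j \<eta>) = F j k \<eta> \<theta>"
    if "1 \<le> j" "j \<le> Suc (Suc n)" "(j, \<eta>) \<noteq> (i, \<epsilon>)" "j < k" "k \<le> Suc (Suc n)" for j \<eta> k \<theta>
  proof -
    have "k - 1 \<in> {1..Suc n}" "\<not> k - 1 < j" "Suc (k - 1) = k" using that by auto
    then show ?thesis using c[OF that(1-3)] unfolding has_boundary_def by metis
  qed
  have "box_family X (Suc n) i \<epsilon> c"
    unfolding box_family_def
  proof (intro conjI allI impI)
    fix j \<eta> assume "1 \<le> j" "j \<le> Suc (Suc n)" "(j, \<eta>) \<noteq> (i, \<epsilon>)"
    from c[OF this] show "c j \<eta> \<in> cells X (Suc n)" by (simp add: has_boundary_def)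
  next
    fix j k \<eta> \<theta>
    assume *: "1 \<le> j" "j < k" "k \<le> Suc (Suc n)" "(j, \<eta>) \<noteq> (i, \<epsilon>)" "(k, \<theta>) \<noteq> (i, \<epsilon>)"
    then have "1 \<le> k" "j \<le> Suc (Suc n)" by auto
    then show "act X (face (Suc n) (k - 1) \<theta>) (c j \<eta>) = act X (face (Suc n) j \<eta>) (c k \<theta>)"
      using c_low[of k \<theta> j \<eta>] c_high[of j \<eta> k \<theta>] * by metis
  qed
  then obtain y where y: "y \<in> cells X (Suc (Suc n))"
    "\<And>j \<eta>. 1 \<le> j \<Longrightarrow> j \<le> Suc (Suc n) \<Longrightarrow> (j, \<eta>) \<noteq> (i, \<epsilon>) \<Longrightarrow>
       act X (face (Suc (Suc n)) j \<eta>) y = c j \<eta>"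
    by (rule box_filling[OF i]) blast
  have "act X (face (Suc n) k \<theta>) (act X (face (Suc (Suc n)) i \<epsilon>) y)
      = (if k < i then F k i \<theta> \<epsilon> else F i (Suc k) \<epsilon> \<theta>)" if k: "k \<in> {1..Suc n}" for k \<theta>
  proof (cases "k < i")
    case True
    have "act X (face (Suc n) k \<theta>) (act X (face (Suc (Suc n)) i \<epsilon>) y)
        = act X (face (Suc n) (i - 1) \<epsilon>) (act X (face (Suc (Suc n)) k \<theta>) y)"
      by (rule act_face_face[symmetric]) (use k i True y in auto)
    then show ?thesis using y(2)[of k \<theta>] c_high[of k \<theta> i \<epsilon>] k i True by simp
  next
    case False
    have "act X (face (Suc n) (Suc k - 1) \<theta>) (act X (face (Suc (Suc n)) i \<epsilon>) y)
        = act X (face (Suc n) i \<epsilon>) (act X (face (Suc (Suc n)) (Suc k) \<theta>) y)"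
      by (rule act_face_face) (use k i False y in auto)
    then show ?thesis using y(2)[of "Suc k" \<theta>] c_low[of "Suc k" \<theta> i \<epsilon>] k i False by simp
  qed
  then have "has_boundary X (Suc n) F i \<epsilon> (act X (face (Suc (Suc n)) i \<epsilon>) y)"
    using act_face_closed[OF i y(1)] by (simp add: has_boundary_def)
  then show ?thesis by blast
qed


section \<open>Spheres and loop spaces\<close>

locale pointed_kan_complex = kan_complex X for X :: "'a cubical_data" +
  fixes x :: 'a
  assumes base_point: "x \<in> cells X 0"
begin

definition const :: "nat \<Rightarrow> 'a" where
  "const n = act X (box_terminal n) x"

text \<open>The representatives of the elements of \<open>homotopy_set n\<close>, seen as cubes of
  \<open>X\<close> itself rather than of an iterated loop space.\<close>

definition sphere :: "nat \<Rightarrow> 'a set" where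
  "sphere n = {c \<in> cells X n. \<forall>j\<in>{1..n}. \<forall>\<epsilon>. act X (face n j \<epsilon>) c = const (n - 1)}"

lemma const_cell [simp]: "const n \<in> cells X n"
  unfolding const_def using act_closed[OF box_hom_terminal base_point] .

lemma act_const: "box_hom m n f \<Longrightarrow> act X f (const n) = const m"
  unfolding const_def using act_comp[OF _ box_hom_terminal base_point] box_terminal_comp by metis

lemma sphere_cell: "c \<in> sphere n \<Longrightarrow> c \<in> cells X n"
  by (simp add: sphere_def)

lemma sphere_face:
  "c \<in> sphere (Suc n) \<Longrightarrow> 1 \<le> j \<Longrightarrow> j \<le> Suc n \<Longrightarrow> act X (face (Suc n) j \<epsilon>) c = const n"
  by (simp add: sphere_def)

lemma const_sphere [simp]: "const n \<in> sphere n"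
proof (cases n)
  case (Suc m) then show ?thesis
    using act_const[OF box_hom_face] by (simp add: sphere_def)
qed (simp add: sphere_def)

text \<open>Such an \<open>f\<close> factors through a facet, and the facets of a sphere are
  constant.\<close>

lemma sphere_act_const:
  assumes c: "c \<in> sphere (Suc n)" and f: "box_hom m (Suc n) f" and i: "1 \<le> i" "i \<le> Suc n"
    and eq: "\<And>v w. f v = Some w \<Longrightarrow> w ! (i - 1) = \<epsilon>"
  shows "act X f c = const m"
proof -
  have g: "box_hom m n (degen (Suc n) i \<circ>\<^sub>m f)" by (rule box_hom_comp[OF f box_hom_degen[OF i]])
  have "f = face (Suc n) i \<epsilon> \<circ>\<^sub>m (degen (Suc n) i \<circ>\<^sub>m f)" by (rule factor_face[OF f i eq])
  then have "act X f c = act X (degen (Suc n) i \<circ>\<^sub>m f) (act X (face (Suc n) i \<epsilon>) c)"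
    using act_comp[OF g box_hom_face[OF i] sphere_cell[OF c]] by metis
  then show ?thesis using sphere_face[OF c i] act_const[OF g] by simp
qed

text \<open>All faces of spheres are the same constant cube, so spheres always fit together, and the
  facet obtained from the filler again has constant boundary.\<close>

lemma sphere_filling:
  assumes i: "1 \<le> i" "i \<le> Suc (Suc n)"
    and c: "\<And>j \<eta>. 1 \<le> j \<Longrightarrow> j \<le> Suc (Suc n) \<Longrightarrow> (j, \<eta>) \<noteq> (i, \<epsilon>) \<Longrightarrow> c j \<eta> \<in> sphere (Suc n)"
  obtains y where "y \<in> cells X (Suc (Suc n))"
    "\<And>j \<eta>. 1 \<le> j \<Longrightarrow> j \<le> Suc (Suc n) \<Longrightarrow> (j, \<eta>) \<noteq> (i, \<epsilon>) \<Longrightarrow>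
       act X (face (Suc (Suc n)) j \<eta>) y = c j \<eta>"
    "act X (face (Suc (Suc n)) i \<epsilon>) y \<in> sphere (Suc n)"
proof -
  have "box_family X (Suc n) i \<epsilon> c"
    unfolding box_family_def using c sphere_face sphere_cell by simp
  then obtain y where y: "y \<in> cells X (Suc (Suc n))"
    "\<And>j \<eta>. 1 \<le> j \<Longrightarrow> j \<le> Suc (Suc n) \<Longrightarrow> (j, \<eta>) \<noteq> (i, \<epsilon>) \<Longrightarrow>
       act X (face (Suc (Suc n)) j \<eta>) y = c j \<eta>"
    by (rule box_filling[OF i]) blast
  have "act X (face (Suc n) k \<theta>) (act X (face (Suc (Suc n)) i \<epsilon>) y) = const n"
    if k: "1 \<le> k" "k \<le> Suc n" for k \<theta>
  proof (cases "k < i")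
    case True
    have "act X (face (Suc n) k \<theta>) (act X (face (Suc (Suc n)) i \<epsilon>) y)
        = act X (face (Suc n) (i - 1) \<epsilon>) (act X (face (Suc (Suc n)) k \<theta>) y)"
      by (rule act_face_face[symmetric]) (use k i True y in auto)
    then show ?thesis using y(2)[of k \<theta>] sphere_face[OF c[of k \<theta>], of "i - 1" \<epsilon>] k i True by simp
  next
    case False
    have "act X (face (Suc n) (Suc k - 1) \<theta>) (act X (face (Suc (Suc n)) i \<epsilon>) y)
        = act X (face (Suc n) i \<epsilon>) (act X (face (Suc (Suc n)) (Suc k) \<theta>) y)"
      by (rule act_face_face) (use k i False y in auto)
    then show ?thesis using y(2)[of "Suc k" \<theta>] sphere_face[OF c[of "Suc k" \<theta>], of i \<epsilon>] k i False by simp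
  qed
  then have "act X (face (Suc (Suc n)) i \<epsilon>) y \<in> sphere (Suc n)"
    using act_face_closed[OF i y(1)] by (simp add: sphere_def)
  with y show thesis by (rule that)
qed

section \<open>The loop space as a Kan complex\<close>

definition \<Omega> :: "'a cubical_data" where
  "\<Omega> = fst (loops (X, x))"

lemma loops_eq: "loops (X, x) = (\<Omega>, const 1)"
proof -
  have "degen 1 1 = box_terminal 1"
    using box_terminal_unique box_hom_degen[of 1 0] by simp
  then show ?thesis by (simp add: \<Omega>_def const_def)
qed

lemma cells_\<Omega>: "cells \<Omega> k = {c \<in> cells X (Suc k). \<forall>\<epsilon>. act X (face (Suc k) 1 \<epsilon>) c = const k}"
  by (simp add: \<Omega>_def path_object_def const_def)

lemma act_\<Omega>: "act \<Omega> f c = act X (box_shift f) c"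
  by (simp add: \<Omega>_def path_object_def)

lemma act_face_\<Omega>:
  assumes "1 \<le> i"
  shows "act \<Omega> (face (Suc n) i \<epsilon>) c = act X (face (Suc (Suc n)) (Suc i) \<epsilon>) c"
  using assms by (simp add: act_\<Omega> box_shift_face)

lemma cubical_set_\<Omega>: "cubical_set \<Omega>"
proof
  fix m n f c assume f: "box_hom m n f" and c: "c \<in> cells \<Omega> n"
  have "act X (face (Suc m) 1 \<epsilon>) (act X (box_shift f) c) = const m" for \<epsilon>
  proof -
    have "act X (face (Suc m) 1 \<epsilon>) (act X (box_shift f) c) = act X (box_shift f \<circ>\<^sub>m face (Suc m) 1 \<epsilon>) c"
      using c box_hom_shift[OF f] box_hom_face[of 1 m \<epsilon>] by (simp add: cells_\<Omega> act_comp)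
    also have "\<dots> = act X f (act X (face (Suc n) 1 \<epsilon>) c)"
      using c box_hom_face[of 1 n \<epsilon>] f by (simp only: box_shift_comp_face cells_\<Omega>) (simp add: act_comp)
    also have "\<dots> = const m" using c f act_const by (simp add: cells_\<Omega>)
    finally show ?thesis .
  qed
  then show "act \<Omega> f c \<in> cells \<Omega> m"
    using c act_closed[OF box_hom_shift[OF f]] by (simp add: cells_\<Omega> act_\<Omega>)
next
  fix n c assume "c \<in> cells \<Omega> n"
  then show "act \<Omega> (box_id n) c = c" by (simp add: cells_\<Omega> act_\<Omega> box_shift_id act_id)
next
  fix l m n f g c assume "box_hom l m f" "box_hom m n g" "c \<in> cells \<Omega> n"
  then show "act \<Omega> (g \<circ>\<^sub>m f) c = act \<Omega> f (act \<Omega> g c)"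
    using act_comp[OF box_hom_shift box_hom_shift] by (simp add: cells_\<Omega> act_\<Omega> box_shift_comp)
qed

text \<open>Adding two constant facets in direction 1 turns an open box of \<open>\<Omega>\<close>
  into one of \<open>X\<close> of dimension one higher, with missing direction \<open>Suc i\<close>.
  The filler in \<open>X\<close> has constant first faces, hence lies in
  \<open>\<Omega>\<close>.\<close>

lemma kan_complex_\<Omega>: "kan_complex \<Omega>"
proof -
  interpret \<Omega>: cubical_set \<Omega> by (rule cubical_set_\<Omega>)
  show ?thesis
  proof
    fix i n \<epsilon> \<phi> assume i: "1 \<le> i" "i \<le> n" and \<phi>: "cubical_map (open_box n i \<epsilon>) \<Omega> \<phi>"
    obtain m where n: "n = Suc m" using i by (cases n) auto
    let ?ok = "\<lambda>j \<eta>. 1 \<le> j \<and> j \<le> n \<and> (j, \<eta>) \<noteq> (i, \<epsilon>)"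
    have box: "face n j \<eta> \<circ>\<^sub>m g \<in> cells (open_box n i \<epsilon>) k" if "?ok j \<eta>" "box_hom k m g" for j \<eta> g k
      using that n by (auto simp: open_box_def std_cube_def)
    have box_face: "face n j \<eta> \<in> cells (open_box n i \<epsilon>) m" if "?ok j \<eta>" for j \<eta>
    proof -
      have "box_hom m n (face n j \<eta>)" using that n box_hom_face by simp
      then show ?thesis using box[OF that box_hom_id] by simp
    qed
    have \<phi>_cell: "\<phi> m (face n j \<eta>) \<in> cells \<Omega> m" if "?ok j \<eta>" for j \<eta>
      using \<phi> box_face[OF that] unfolding cubical_map_def by blast
    have \<phi>_act: "\<phi> k (face n j \<eta> \<circ>\<^sub>m g) = act \<Omega> g (\<phi> m (face n j \<eta>))"
      if "?ok j \<eta>" "box_hom k m g" for j \<eta> k g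
    proof -
      have "\<phi> k (act (open_box n i \<epsilon>) g (face n j \<eta>)) = act \<Omega> g (\<phi> m (face n j \<eta>))"
        using \<phi> box_face[OF that(1)] that(2) unfolding cubical_map_def by blast
      then show ?thesis by (simp add: open_box_def std_cube_def)
    qed
    define c where "c j \<eta> = (if j = 1 then const n else \<phi> m (face n (j - 1) \<eta>))" for j \<eta>
    have "box_family X n (Suc i) \<epsilon> c"
      unfolding box_family_def
    proof (intro conjI allI impI)
      fix j \<eta> assume j: "1 \<le> j" "j \<le> Suc n" "(j, \<eta>) \<noteq> (Suc i, \<epsilon>)"
      show "c j \<eta> \<in> cells X n"
      proof (cases "j = 1")
        case False
        then have "?ok (j - 1) \<eta>" using j by auto
        from \<phi>_cell[OF this] show ?thesis using False by (simp add: c_def cells_\<Omega> n)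
      qed (simp add: c_def)
    next
      fix j k \<eta> \<theta>
      assume jk: "1 \<le> j" "j < k" "k \<le> Suc n" and ne: "(j, \<eta>) \<noteq> (Suc i, \<epsilon>)" "(k, \<theta>) \<noteq> (Suc i, \<epsilon>)"
      obtain k' where k: "k = Suc k'" "1 \<le> k'" using jk by (cases k) auto
      have ok_k: "?ok k' \<theta>" using k jk ne by auto
      show "act X (face n (k - 1) \<theta>) (c j \<eta>) = act X (face n j \<eta>) (c k \<theta>)"
      proof (cases "j = 1")
        case True
        \<comment> \<open>The added facets match the others because cubes of \<open>\<Omega>\<close>
          have constant first faces.\<close>
        have "act X (face n (k - 1) \<theta>) (const n) = const m"
          unfolding n by (rule act_const) (use k jk n in \<open>auto intro!: box_hom_face\<close>)
        then show ?thesis using True k \<phi>_cell[OF ok_k] by (simp add: c_def cells_\<Omega> n)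
      next
        case False
        then obtain j' where j: "j = Suc j'" "1 \<le> j'" using jk by (cases j) auto
        have ok_j: "?ok j' \<eta>" using j jk ne by auto
        obtain l where m: "m = Suc l" using j k jk n by (cases m) auto
        have 1: "box_hom l m (face m (k' - 1) \<theta>)" "box_hom l m (face m j' \<eta>)"
          using j k jk n m by (auto intro!: box_hom_face)
        have "face n j' \<eta> \<circ>\<^sub>m face m (k' - 1) \<theta> = face n k' \<theta> \<circ>\<^sub>m face m j' \<eta>"
          using face_comp_face[of j' k' l \<eta> \<theta>] j k jk n m by simp
        then have "act \<Omega> (face m (k' - 1) \<theta>) (\<phi> m (face n j' \<eta>)) = act \<Omega> (face m j' \<eta>) (\<phi> m (face n k' \<theta>))"
          using \<phi>_act[OF ok_j 1(1)] \<phi>_act[OF ok_k 1(2)] by simp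
        moreover have "1 \<le> k' - 1" "Suc (k' - 1) = k'" using j k jk by auto
        ultimately have "act X (face n k' \<theta>) (\<phi> m (face n j' \<eta>)) = act X (face n j \<eta>) (\<phi> m (face n k' \<theta>))"
          using act_face_\<Omega>[of "k' - 1" l] act_face_\<Omega>[of j' l] j unfolding m n by simp
        then show ?thesis using j k by (simp add: c_def)
      qed
    qed
    then obtain y where y: "y \<in> cells X (Suc n)"
      "\<And>j \<eta>. 1 \<le> j \<Longrightarrow> j \<le> Suc n \<Longrightarrow> (j, \<eta>) \<noteq> (Suc i, \<epsilon>) \<Longrightarrow> act X (face (Suc n) j \<eta>) y = c j \<eta>"
      by (rule box_filling[rotated 2]) (use i in auto)
    have y\<Omega>: "y \<in> cells \<Omega> n" using y(1) y(2)[of 1] i by (simp add: cells_\<Omega> c_def)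
    have y_face: "act \<Omega> (face n j \<eta>) y = \<phi> m (face n j \<eta>)" if "?ok j \<eta>" for j \<eta>
      using y(2)[of "Suc j" \<eta>] that act_face_\<Omega>[of j m \<eta> y] by (auto simp: c_def n)
    have "act \<Omega> f y = \<phi> k f" if "f \<in> cells (open_box n i \<epsilon>) k" for k f
    proof -
      obtain j \<eta> g where f: "f = face n j \<eta> \<circ>\<^sub>m g" and ok: "?ok j \<eta>" and g: "box_hom k m g"
        using \<open>f \<in> _\<close> unfolding open_box_def std_cube_def n by auto
      have "box_hom m n (face n j \<eta>)" using ok n box_hom_face by simp
      then show ?thesis using \<Omega>.act_comp[OF g _ y\<Omega>] y_face[OF ok] \<phi>_act[OF ok g] f by simp
    qed
    with \<Omega>.cubical_map_of_cell[OF y\<Omega>]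
    show "\<exists>\<psi>. cubical_map (std_cube n) \<Omega> \<psi> \<and> (\<forall>k. \<forall>c\<in>cells (open_box n i \<epsilon>) k. \<psi> k c = \<phi> k c)"
      by blast
  qed
qed

lemma pointed_kan_complex_\<Omega>: "pointed_kan_complex \<Omega> (const 1)"
  using kan_complex_\<Omega> act_const[OF box_hom_face[of 1 0]]
  by (simp add: pointed_kan_complex_def pointed_kan_complex_axioms_def cells_\<Omega>)

end


section \<open>Connected components\<close>

definition joined :: "'a cubical_data \<Rightarrow> 'a \<Rightarrow> 'a \<Rightarrow> bool" where
  "joined X a b \<longleftrightarrow> (\<exists>h\<in>cells X 1. act X (face 1 1 False) h = a \<and> act X (face 1 1 True) h = b)"

lemma sym_colim_rel: "sym (colim_rel X)"
  by (simp add: colim_rel_def sym_rtrancl sym_Un_converse)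

lemma trans_colim_rel: "trans (colim_rel X)"
  by (simp add: colim_rel_def trans_rtrancl)

lemma colim_rel_act:
  assumes "box_hom m n f" "c \<in> cells X n"
  shows "((n, c), (m, act X f c)) \<in> colim_rel X"
  unfolding colim_rel_def colim_step_def using assms by (intro r_into_rtrancl) blast

lemma colim_rel_Image_eq_iff: "colim_rel X `` {a} = colim_rel X `` {b} \<longleftrightarrow> (a, b) \<in> colim_rel X"
proof
  have "(b, b) \<in> colim_rel X" by (simp add: colim_rel_def)
  then show "(a, b) \<in> colim_rel X" if "colim_rel X `` {a} = colim_rel X `` {b}" using that by blast
  show "colim_rel X `` {a} = colim_rel X `` {b}" if "(a, b) \<in> colim_rel X"
    using that sym_colim_rel trans_colim_rel by (blast dest: symD transD)
qed

lemma (in cubical_set) pi0_eq: "pi0 X = pi0_class X ` cells X 0"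
proof
  show "pi0 X \<subseteq> pi0_class X ` cells X 0"
  proof
    fix C assume "C \<in> pi0 X"
    then obtain n c where c: "c \<in> cells X n" and C: "C = colim_rel X `` {(n, c)}"
      unfolding pi0_def by (auto elim!: quotientE)
    obtain v where v: "box_hom 0 n v" using ex_vertex by blast
    have "C = pi0_class X (act X v c)"
      unfolding C pi0_class_def colim_rel_Image_eq_iff by (rule colim_rel_act[OF v c])
    then show "C \<in> pi0_class X ` cells X 0" using act_closed[OF v c] by blast
  qed
  show "pi0_class X ` cells X 0 \<subseteq> pi0 X"
    unfolding pi0_def pi0_class_def by (auto intro!: quotientI)
qed

context cubical_set
begin

lemma joined_refl: "a \<in> cells X 0 \<Longrightarrow> joined X a a"
proof -
  assume a: "a \<in> cells X 0"
  have d: "box_hom 1 0 (degen 1 1)" using box_hom_degen[of 1 0] by simp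
  have f: "box_hom 0 1 (face 1 1 \<epsilon>)" for \<epsilon> using box_hom_face[of 1 0] by simp
  have "act X (face 1 1 \<epsilon>) (act X (degen 1 1) a) = a" for \<epsilon>
    using act_comp[OF f d a, of \<epsilon>] degen_comp_face[of 1 0 \<epsilon>] act_id[OF a] by simp
  then show ?thesis using act_closed[OF d a] unfolding joined_def by blast
qed

lemma joined_cells:
  assumes "joined X a b"
  shows "a \<in> cells X 0" and "b \<in> cells X 0"
  using assms act_closed[OF box_hom_face[of 1 0]] unfolding joined_def by auto

text \<open>The generated relation passes through cells of all dimensions. The invariant along a
  zigzag starting at \<open>a\<close> is that every vertex of the current cell is joined to
  \<open>a\<close>.\<close>

lemma pi0_class_eq_iff:
  assumes joined_sym: "\<And>a b. joined X a b \<Longrightarrow> joined X b a"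
    and joined_trans: "\<And>a b c. joined X a b \<Longrightarrow> joined X b c \<Longrightarrow> joined X a c"
    and ab: "a \<in> cells X 0" "b \<in> cells X 0"
  shows "pi0_class X a = pi0_class X b \<longleftrightarrow> joined X a b"
proof
  have vertices: "joined X (act X v c) (act X w c)"
    if "box_hom 0 n v" "box_hom 0 n w" "c \<in> cells X n" for n v w c
    using that
  proof (induction n arbitrary: v w c)
    case 0
    then have "v = w" using box_terminal_unique by blast
    then show ?case using joined_refl act_closed[OF 0(1,3)] by simp
  next
    case (Suc n)
    have split: "\<exists>v' \<eta>. box_hom 0 n v' \<and> v = face (Suc n) 1 \<eta> \<circ>\<^sub>m v'" if v: "box_hom 0 (Suc n) v" for v
    proof -
      have "\<And>u z. v u = Some z \<Longrightarrow> z ! (1 - 1) = the (v []) ! 0"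
        using box_hom_length(1)[OF v] by (metis diff_self_eq_0 length_0_conv option.distinct(1) option.sel)
      then have "v = face (Suc n) 1 (the (v []) ! 0) \<circ>\<^sub>m (degen (Suc n) 1 \<circ>\<^sub>m v)"
        using factor_face[OF v, of 1] by simp
      then show ?thesis using box_hom_comp[OF v box_hom_degen[of 1 n]] by auto
    qed
    obtain v' \<eta> where v': "box_hom 0 n v'" "v = face (Suc n) 1 \<eta> \<circ>\<^sub>m v'" using split Suc.prems by blast
    obtain w' \<theta> where w': "box_hom 0 n w'" "w = face (Suc n) 1 \<theta> \<circ>\<^sub>m w'" using split Suc.prems by blast
    have f: "box_hom n (Suc n) (face (Suc n) 1 \<epsilon>)" for \<epsilon> using box_hom_face by simp
    \<comment> \<open>The path from \<open>v\<close> to \<open>w\<close> first changes all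
      coordinates but the first, inside one facet, and then the first one, along the edge
      \<open>box_shift w'\<close>.\<close>
    let ?u = "\<lambda>\<epsilon>. act X (face (Suc n) 1 \<epsilon> \<circ>\<^sub>m w') c"
    have 1: "joined X (act X v c) (?u \<eta>)"
      using Suc.IH[OF v'(1) w'(1) act_closed[OF f Suc.prems(3), of \<eta>]] v'(2)
        act_comp[OF v'(1) f Suc.prems(3), of \<eta>] act_comp[OF w'(1) f Suc.prems(3), of \<eta>] by simp
    let ?h = "act X (box_shift w') c"
    have sw: "box_hom 1 (Suc n) (box_shift w')" using box_hom_shift[OF w'(1)] by simp
    have f1: "box_hom 0 1 (face 1 1 \<epsilon>)" for \<epsilon> using box_hom_face[of 1 0] by simp
    have "act X (face 1 1 \<epsilon>) ?h = ?u \<epsilon>" for \<epsilon>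
      using act_comp[OF f1 sw Suc.prems(3), of \<epsilon>] box_shift_comp_face[OF w'(1), of \<epsilon>] by simp
    then have "joined X (?u False) (?u True)"
      unfolding joined_def using act_closed[OF sw Suc.prems(3)] by blast
    then have "joined X (?u \<eta>) (?u \<theta>)"
      using joined_sym joined_refl[OF act_closed[OF box_hom_comp[OF w'(1) f] Suc.prems(3)]]
      by (cases \<eta>; cases \<theta>) auto
    then show ?case using joined_trans[OF 1] w' by simp
  qed
  have *: "snd q \<in> cells X (fst q) \<and>
      (\<forall>v. box_hom 0 (fst q) v \<longrightarrow> joined X a (act X v (snd q)))"
    if "((0, a), q) \<in> colim_rel X" for q
    using that unfolding colim_rel_def
  proof (induction q rule: rtrancl_induct)
    case base
    show ?case using vertices[OF box_hom_id _ ab(1)] ab(1) act_id by simp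
  next
    case (step p q)
    from step.hyps(2) consider
      m n f c where "box_hom m n f" "c \<in> cells X n" "p = (n, c)" "q = (m, act X f c)"
    | m n f c where "box_hom m n f" "c \<in> cells X n" "q = (n, c)" "p = (m, act X f c)"
      unfolding colim_step_def by blast
    then show ?case
    proof cases
      case 1
      have "joined X a (act X v (act X f c))" if v: "box_hom 0 m v" for v
      proof -
        have "joined X a (act X (f \<circ>\<^sub>m v) c)" using step.IH 1(3) box_hom_comp[OF v 1(1)] by simp
        then show ?thesis using act_comp[OF v 1(1,2)] by simp
      qed
      then show ?thesis using 1 act_closed by simp
    next
      case 2
      \<comment> \<open>Backward step: a vertex of \<open>act X f c\<close> is a vertex of
        \<open>c\<close>, and from it all other vertices of \<open>c\<close> are reached.\<close>
      obtain u where u: "box_hom 0 m u" using ex_vertex by blast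
      have "joined X a (act X (f \<circ>\<^sub>m u) c)"
        using step.IH 2 u act_comp[OF u 2(1,2)] by simp
      then show ?thesis
        using 2 vertices[OF box_hom_comp[OF u 2(1)] _ 2(2)] joined_trans by simp
    qed
  qed
  show "joined X a b" if "pi0_class X a = pi0_class X b"
    using that *[of "(0, b)"] act_id[OF ab(2)] box_hom_id[of 0]
    unfolding pi0_class_def colim_rel_Image_eq_iff by force
  show "pi0_class X a = pi0_class X b" if ab': "joined X a b"
  proof -
    obtain h where h: "h \<in> cells X 1" "act X (face 1 1 False) h = a" "act X (face 1 1 True) h = b"
      using ab' unfolding joined_def by blast
    have "box_hom 0 1 (face 1 1 \<epsilon>)" for \<epsilon> using box_hom_face[of 1 0] by simp
    from colim_rel_act[OF this h(1)] show ?thesis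
      using h(2,3) colim_rel_Image_eq_iff unfolding pi0_class_def by metis
  qed
qed

end


section \<open>Squares of loops and the fundamental group\<close>

definition square :: "'a cubical_data \<Rightarrow> 'a \<Rightarrow> 'a \<Rightarrow> 'a \<Rightarrow> 'a \<Rightarrow> bool" where
  "square X a b c d \<longleftrightarrow> (\<exists>s\<in>cells X 2.
     act X (face 2 1 False) s = a \<and> act X (face 2 1 True) s = b \<and>
     act X (face 2 2 False) s = c \<and> act X (face 2 2 True) s = d)"

lemma has_boundary_2:
  "has_boundary X 2 F j \<eta> y \<longleftrightarrow> y \<in> cells X 2 \<and> (\<forall>\<theta>.
     act X (face 2 1 \<theta>) y = (if 1 < j then F 1 j \<theta> \<eta> else F j 2 \<eta> \<theta>) \<and>
     act X (face 2 2 \<theta>) y = (if 2 < j then F 2 j \<theta> \<eta> else F j 3 \<eta> \<theta>))"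
proof -
  have "{1..2::nat} = {1, 2}" by auto
  then show ?thesis by (auto simp: has_boundary_def eval_nat_numeral)
qed

text \<open>\<open>missing_face\<close> for a 3-cube lacking the facet at value 0 in direction 2.
  Its edges are \<open>r\<close>, \<open>q\<close> and \<open>p\<close>, indexed by the values of
  coordinates 1 and 2, of 1 and 3, and of 2 and 3.\<close>

lemma (in kan_complex) missing_square:
  assumes "\<And>\<epsilon>. square X (r \<epsilon> False) (r \<epsilon> True) (q \<epsilon> False) (q \<epsilon> True)"
    and "square X (r False True) (r True True) (p True False) (p True True)"
    and "\<And>\<epsilon>. square X (q False \<epsilon>) (q True \<epsilon>) (p False \<epsilon>) (p True \<epsilon>)"
  shows "square X (r False False) (r True False) (p False False) (p False True)"
proof -
  define F :: "nat \<Rightarrow> nat \<Rightarrow> bool \<Rightarrow> bool \<Rightarrow> 'a" where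
    "F j k = (if j = 1 then if k = 2 then r else q else p)" for j k
  have "\<exists>y. has_boundary X (Suc 1) F 2 False y"
  proof (rule missing_face)
    fix j :: nat and \<eta> assume "1 \<le> j" "j \<le> Suc (Suc 1)" and ne: "(j, \<eta>) \<noteq> (2, False)"
    then consider "j = 1" | "j = 2" "\<eta>" | "j = 3" by fastforce
    then show "\<exists>y. has_boundary X (Suc 1) F j \<eta> y"
    proof cases
      case 1 with assms(1)[of \<eta>] show ?thesis
        unfolding square_def Suc_1 has_boundary_2 F_def by (auto simp: all_bool_eq)
    next
      case 2 with assms(2) show ?thesis
        unfolding square_def Suc_1 has_boundary_2 F_def by (auto simp: all_bool_eq)
    next
      case 3 with assms(3)[of \<eta>] show ?thesis
        unfolding square_def Suc_1 has_boundary_2 F_def by (auto simp: all_bool_eq)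
    qed
  qed auto
  then show ?thesis
    unfolding square_def Suc_1 has_boundary_2 F_def by auto
qed

context pointed_kan_complex
begin

text \<open>The face cancels the degeneracy in its own direction. In any other direction the
  inserted coordinate survives the deletion, at position \<open>?p\<close>, so
  \<open>sphere_act_const\<close> applies.\<close>

lemma act_degen_sphere:
  assumes a: "a \<in> sphere (Suc n)" and i: "1 \<le> i" "i \<le> Suc (Suc n)" and j: "1 \<le> j" "j \<le> Suc (Suc n)"
  shows "act X (face (Suc (Suc n)) j \<epsilon>) (act X (degen (Suc (Suc n)) i) a)
       = (if j = i then a else const (Suc n))"
proof -
  have d: "box_hom (Suc (Suc n)) (Suc n) (degen (Suc (Suc n)) i)" by (rule box_hom_degen[OF i])
  have f: "box_hom (Suc n) (Suc (Suc n)) (face (Suc (Suc n)) j \<epsilon>)" by (rule box_hom_face[OF j])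
  have df: "act X (face (Suc (Suc n)) j \<epsilon>) (act X (degen (Suc (Suc n)) i) a)
      = act X (degen (Suc (Suc n)) i \<circ>\<^sub>m face (Suc (Suc n)) j \<epsilon>) a"
    by (rule act_comp[OF f d sphere_cell[OF a], symmetric])
  show ?thesis
  proof (cases "j = i")
    case True
    then show ?thesis using df degen_comp_face[OF i, of \<epsilon>] act_id[OF sphere_cell[OF a]] by simp
  next
    case False
    let ?p = "if j < i then j else j - 1"
    have "w ! (?p - 1) = \<epsilon>"
      if w: "(degen (Suc (Suc n)) i \<circ>\<^sub>m face (Suc (Suc n)) j \<epsilon>) v = Some w" for v w
    proof -
      obtain u where u: "face (Suc (Suc n)) j \<epsilon> v = Some u" "degen (Suc (Suc n)) i u = Some w"
        using w by (auto simp: map_comp_Some_iff)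
      have "u ! (j - 1) = \<epsilon>" by (rule face_nth[OF j u(1)])
      moreover have "length u = Suc (Suc n)" "w = take (i - 1) u @ drop i u"
        using u(2) by (auto simp: degen_def split: if_splits)
      ultimately show ?thesis using False i j by (auto simp: nth_append min_def)
    qed
    then have "act X (degen (Suc (Suc n)) i \<circ>\<^sub>m face (Suc (Suc n)) j \<epsilon>) a = const (Suc n)"
      by (rule sphere_act_const[OF a box_hom_comp[OF f d], rotated 2]) (use False i j in auto)
    then show ?thesis using df False by simp
  qed
qed

text \<open>For a maximum, setting one merged coordinate to 0 leaves the other one, while setting it
  to 1 makes the result constantly 1. In all other directions the inserted coordinate
  survives.\<close>

lemma act_conn_sphere:
  assumes a: "a \<in> sphere (Suc n)" and i: "1 \<le> i" "i \<le> Suc n" and j: "1 \<le> j" "j \<le> Suc (Suc n)"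
  shows "act X (face (Suc (Suc n)) j \<epsilon>) (act X (conn (Suc (Suc n)) i False) a)
       = (if (j = i \<or> j = Suc i) \<and> \<not> \<epsilon> then a else const (Suc n))"
proof -
  have d: "box_hom (Suc (Suc n)) (Suc n) (conn (Suc (Suc n)) i False)" by (rule box_hom_conn[OF i])
  have f: "box_hom (Suc n) (Suc (Suc n)) (face (Suc (Suc n)) j \<epsilon>)" by (rule box_hom_face[OF j])
  have df: "act X (face (Suc (Suc n)) j \<epsilon>) (act X (conn (Suc (Suc n)) i False) a)
      = act X (conn (Suc (Suc n)) i False \<circ>\<^sub>m face (Suc (Suc n)) j \<epsilon>) a"
    by (rule act_comp[OF f d sphere_cell[OF a], symmetric])
  show ?thesis
  proof (cases "(j = i \<or> j = Suc i) \<and> \<not> \<epsilon>")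
    case True
    have "conn (Suc (Suc n)) i False \<circ>\<^sub>m face (Suc (Suc n)) j \<epsilon> = box_id (Suc n)"
    proof (rule box_map_eqI[OF box_hom_comp[OF f d] box_hom_id])
      fix v :: "bool list" assume v: "length v = Suc n"
      obtain l where l: "i = Suc l" "l < length v" using i v by (cases i) auto
      have "take l v @ v ! l # drop (Suc l) v = v" using id_take_nth_drop[OF l(2)] by (rule sym)
      moreover have "take (Suc l) v = take l v @ [v ! l]" by (rule take_Suc_conv_app_nth[OF l(2)])
      moreover have "drop l v = v ! l # drop (Suc l) v" by (rule Cons_nth_drop_Suc[OF l(2), symmetric])
      ultimately show "(conn (Suc (Suc n)) i False \<circ>\<^sub>m face (Suc (Suc n)) j \<epsilon>) v = box_id (Suc n) v"
        using True v l by (auto simp: face_eq conn_def box_id_def nth_append)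
    qed
    then show ?thesis using df act_id[OF sphere_cell[OF a]] True by simp
  next
    case False
    let ?p = "if j \<le> i then j else j - 1"
    have "w ! (?p - 1) = \<epsilon>"
      if w: "(conn (Suc (Suc n)) i False \<circ>\<^sub>m face (Suc (Suc n)) j \<epsilon>) v = Some w" for v w
    proof -
      obtain u where u: "face (Suc (Suc n)) j \<epsilon> v = Some u" "conn (Suc (Suc n)) i False u = Some w"
        using w by (auto simp: map_comp_Some_iff)
      have "u ! (j - 1) = \<epsilon>" by (rule face_nth[OF j u(1)])
      moreover have "length u = Suc (Suc n)"
        "w = take (i - 1) u @ [u ! (i - 1) \<or> u ! i] @ drop (i + 1) u"
        using u(2) by (auto simp: conn_def split: if_splits)
      moreover obtain l where "i = Suc l" using i by (cases i) auto
      moreover obtain k where "j = Suc k" using j by (cases j) auto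
      ultimately have w: "u ! k = \<epsilon>" "length u = Suc (Suc n)" "i = Suc l" "j = Suc k"
        "w = take l u @ (u ! l \<or> u ! Suc l) # drop (Suc (Suc l)) u" by simp_all
      consider "k < l" | "k = l" | "k = Suc l" | "Suc l < k" by linarith
      then show ?thesis
      proof cases
        case 4
        then obtain m where "k = Suc (Suc l + m)" using less_imp_Suc_add by blast
        then show ?thesis using w i j by (simp add: nth_append)
      qed (use w i j False in \<open>auto simp: nth_append\<close>)
    qed
    then have "act X (conn (Suc (Suc n)) i False \<circ>\<^sub>m face (Suc (Suc n)) j \<epsilon>) a = const (Suc n)"
      by (rule sphere_act_const[OF a box_hom_comp[OF f d], rotated 2]) (use False i j in auto)
    then show ?thesis using df False by auto
  qed
qed

lemma degen_square:
  assumes a: "a \<in> sphere 1"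
  shows "square X a a (const 1) (const 1)" and "square X (const 1) (const 1) a a"
proof -
  have cell: "act X (degen 2 i) a \<in> cells X 2" if "1 \<le> i" "i \<le> 2" for i
    using act_closed[OF box_hom_degen[of i 1] sphere_cell[OF a]] that by (simp add: numeral_2_eq_2)
  have face: "act X (face 2 j \<epsilon>) (act X (degen 2 i) a) = (if j = i then a else const 1)"
    if "1 \<le> i" "i \<le> 2" "1 \<le> j" "j \<le> 2" for i j \<epsilon>
    using act_degen_sphere[of a 0 i j \<epsilon>] that a by (simp add: numeral_2_eq_2)
  show "square X a a (const 1) (const 1)" unfolding square_def
    by (rule bexI[OF _ cell[of 1]]) (simp_all add: face)
  show "square X (const 1) (const 1) a a" unfolding square_def
    by (rule bexI[OF _ cell[of 2]]) (simp_all add: face)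
qed

text \<open>The two squares are the ends of a 3-cube in direction 3, the three homotopies are sides,
  and the missing side is the conclusion. With degenerate squares it also yields symmetry and
  transitivity of homotopy.\<close>

lemma square_cong:
  assumes "square X a b c d" "square X a' b' c' d'"
    and "square X (const 1) (const 1) a a'" "square X (const 1) (const 1) b b'"
    and "square X (const 1) (const 1) d d'"
  shows "square X (const 1) (const 1) c c'"
  using missing_square[of "\<lambda>_ _. const 1" "\<lambda>\<epsilon> \<theta>. if \<epsilon> then if \<theta> then b' else b else if \<theta> then a' else a"
    "\<lambda>\<epsilon> \<theta>. if \<epsilon> then if \<theta> then d' else d else if \<theta> then c' else c"] assms
  by (simp add: all_bool_eq split: if_splits)

lemma cells_\<Omega>_0: "cells \<Omega> 0 = sphere 1"
  by (simp add: cells_\<Omega> sphere_def)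

lemma joined_\<Omega>_iff: "joined \<Omega> a b \<longleftrightarrow> square X (const 1) (const 1) a b"
  using act_face_\<Omega>[of 1 0]
  by (auto simp: joined_def square_def cells_\<Omega> all_bool_eq numeral_2_eq_2)

lemma joined_\<Omega>_sym: "joined \<Omega> a b \<Longrightarrow> joined \<Omega> b a"
proof -
  assume ab: "joined \<Omega> a b"
  then have "b \<in> sphere 1" using cubical_set.joined_cells(2)[OF cubical_set_\<Omega>] cells_\<Omega>_0 by blast
  \<comment> \<open>The degenerate square on \<open>b\<close> and the homotopy from \<open>a\<close>
    to \<open>b\<close> share the edge \<open>b\<close>; \<open>square_cong\<close> compares their
    opposite edges \<open>b\<close> and \<open>a\<close>.\<close>
  from degen_square(2)[OF this] ab show ?thesis
    unfolding joined_\<Omega>_iff using degen_square(2)[OF const_sphere] by (blast intro: square_cong)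
qed

lemma joined_\<Omega>_trans: "joined \<Omega> a b \<Longrightarrow> joined \<Omega> b c \<Longrightarrow> joined \<Omega> a c"
proof -
  assume ab: "joined \<Omega> a b" and bc: "joined \<Omega> b c"
  then have "c \<in> sphere 1" using cubical_set.joined_cells(2)[OF cubical_set_\<Omega>] cells_\<Omega>_0 by blast
  \<comment> \<open>Here the homotopy from \<open>a\<close> to \<open>b\<close> is compared with the
    degenerate square on \<open>c\<close>; their last edges \<open>b\<close> and \<open>c\<close>
    are homotopic.\<close>
  from degen_square(2)[OF this] ab bc show ?thesis
    unfolding joined_\<Omega>_iff using degen_square(2)[OF const_sphere] by (blast intro: square_cong)
qed

lemma class_eq_iff:
  assumes "a \<in> sphere 1" "b \<in> sphere 1"
  shows "pi0_class \<Omega> a = pi0_class \<Omega> b \<longleftrightarrow> square X (const 1) (const 1) a b"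
  unfolding joined_\<Omega>_iff[symmetric]
  using joined_\<Omega>_sym joined_\<Omega>_trans assms unfolding cells_\<Omega>_0[symmetric]
  by (rule cubical_set.pi0_class_eq_iff[OF cubical_set_\<Omega>])

section \<open>The group law on classes of loops\<close>

lemma ex_product:
  assumes "f \<in> sphere 1" "g \<in> sphere 1"
  shows "\<exists>h\<in>sphere 1. square X f (const 1) h g"
proof -
  let ?c = "\<lambda>j \<eta>. if j = 1 then if \<eta> then const 1 else f else g"
  obtain y where y: "y \<in> cells X (Suc (Suc 0))"
    "\<And>j \<eta>. 1 \<le> j \<Longrightarrow> j \<le> Suc (Suc 0) \<Longrightarrow> (j, \<eta>) \<noteq> (2, False) \<Longrightarrow>
       act X (face (Suc (Suc 0)) j \<eta>) y = ?c j \<eta>"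
    "act X (face (Suc (Suc 0)) 2 False) y \<in> sphere (Suc 0)"
    by (rule sphere_filling[of 2 0 False ?c]) (use assms in auto)
  show ?thesis
    unfolding square_def numeral_2_eq_2
    by (rule bexI[OF _ y(3)[unfolded numeral_2_eq_2, folded One_nat_def]], rule bexI[OF _ y(1)])
      (simp add: y(2))
qed

text \<open>The open box lacks the edge of the first factor instead of that of the product.\<close>

lemma ex_left_inverse:
  assumes "f \<in> sphere 1"
  shows "\<exists>g\<in>sphere 1. square X g (const 1) (const 1) f"
proof -
  let ?c = "\<lambda>j \<eta>. if j = 2 \<and> \<eta> then f else const 1"
  obtain y where y: "y \<in> cells X (Suc (Suc 0))"
    "\<And>j \<eta>. 1 \<le> j \<Longrightarrow> j \<le> Suc (Suc 0) \<Longrightarrow> (j, \<eta>) \<noteq> (1, False) \<Longrightarrow>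
       act X (face (Suc (Suc 0)) j \<eta>) y = ?c j \<eta>"
    "act X (face (Suc (Suc 0)) 1 False) y \<in> sphere (Suc 0)"
    by (rule sphere_filling[of 1 0 False ?c]) (use assms in auto)
  show ?thesis
    unfolding square_def numeral_2_eq_2
    by (rule bexI[OF _ y(3)[folded One_nat_def]], rule bexI[OF _ y(1)]) (simp add: y(2))
qed

text \<open>In the 3-cube the given squares lie at value 0 in direction 1 and at both values in
  direction 3; the square at value 1 in direction 2 is degenerate on \<open>h\<close>, and the one
  at value 1 in direction 1 is constant.\<close>

lemma square_assoc:
  assumes "square X f (const 1) u g" "square X g (const 1) v h" "square X u (const 1) w h"
    and "h \<in> sphere 1"
  shows "square X f (const 1) w v"
  using missing_square[of "\<lambda>\<epsilon> \<theta>. if \<epsilon> \<or> \<theta> then const 1 else f"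
    "\<lambda>\<epsilon> \<theta>. if \<epsilon> then const 1 else if \<theta> then g else u"
    "\<lambda>\<epsilon> \<theta>. if \<epsilon> then h else if \<theta> then v else w"]
    assms degen_square(2)[OF assms(4)] degen_square(2)[OF const_sphere]
  by (simp add: all_bool_eq split: if_splits)

text \<open>The definite description is resolved by \<open>square_cong\<close>: the class of the
  remaining edge is the same for all representatives and all fillers.\<close>

lemma pi1_mult_class:
  assumes f: "f \<in> sphere 1" and g: "g \<in> sphere 1" and h: "h \<in> sphere 1"
    and fgh: "square X f (const 1) h g"
  shows "pi1_mult (X, x) (pi0_class \<Omega> f) (pi0_class \<Omega> g) = pi0_class \<Omega> h"
proof -
  have e: "act X (degen 1 1) x = const 1" using loops_eq by simp
  have "pi1_mult (X, x) (pi0_class \<Omega> f) (pi0_class \<Omega> g) =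
    (THE C. \<exists>f'\<in>sphere 1. \<exists>g'\<in>sphere 1. \<exists>h'.
       pi0_class \<Omega> f = pi0_class \<Omega> f' \<and> pi0_class \<Omega> g = pi0_class \<Omega> g' \<and>
       square X f' (const 1) h' g' \<and> C = pi0_class \<Omega> h')"
    unfolding pi1_mult.simps Let_def \<Omega>_def[symmetric] cells_\<Omega>_0 square_def e
    by (rule arg_cong[of _ _ The], rule ext) blast
  also have "\<dots> = pi0_class \<Omega> h"
  proof (rule the_equality)
    show "\<exists>f'\<in>sphere 1. \<exists>g'\<in>sphere 1. \<exists>h'.
       pi0_class \<Omega> f = pi0_class \<Omega> f' \<and> pi0_class \<Omega> g = pi0_class \<Omega> g' \<and>
       square X f' (const 1) h' g' \<and> pi0_class \<Omega> h = pi0_class \<Omega> h'"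
      using assms by blast
    fix C assume "\<exists>f'\<in>sphere 1. \<exists>g'\<in>sphere 1. \<exists>h'.
       pi0_class \<Omega> f = pi0_class \<Omega> f' \<and> pi0_class \<Omega> g = pi0_class \<Omega> g' \<and>
       square X f' (const 1) h' g' \<and> C = pi0_class \<Omega> h'"
    then obtain f' g' h' where *: "f' \<in> sphere 1" "g' \<in> sphere 1"
       "pi0_class \<Omega> f = pi0_class \<Omega> f'" "pi0_class \<Omega> g = pi0_class \<Omega> g'"
       "square X f' (const 1) h' g'" and C: "C = pi0_class \<Omega> h'" by blast
    have "square X (const 1) (const 1) h h'"
      using square_cong[OF fgh *(5)] * f g degen_square(2)[OF const_sphere] class_eq_iff by simp
    \<comment> \<open>That the remaining edge of an arbitrary filler is a loop follows from its
      homotopy to \<open>h\<close>.\<close>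
    moreover from this have "h' \<in> sphere 1"
      using cubical_set.joined_cells(2)[OF cubical_set_\<Omega>] cells_\<Omega>_0 joined_\<Omega>_iff by blast
    ultimately show "C = pi0_class \<Omega> h" using h C class_eq_iff[of h h'] by simp
  qed
  finally show ?thesis .
qed

lemma fundamental_group_simps:
  "carrier (fundamental_group (X, x)) = pi0_class \<Omega> ` sphere 1"
  "mult (fundamental_group (X, x)) = pi1_mult (X, x)"
  "one (fundamental_group (X, x)) = pi0_class \<Omega> (const 1)"
  using cubical_set.pi0_eq[OF cubical_set_\<Omega>]
  by (simp_all add: fundamental_group_def homotopy_set_def loops_eq cells_\<Omega>_0 del: loops.simps)

theorem group_fundamental_group: "group (fundamental_group (X, x))"
proof (rule groupI, unfold fundamental_group_simps)
  let ?cl = "pi0_class \<Omega>"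
  show "?cl (const 1) \<in> ?cl ` sphere 1" by simp
  fix A assume "A \<in> ?cl ` sphere 1"
  then obtain f where f: "f \<in> sphere 1" "A = ?cl f" by blast
  show "pi1_mult (X, x) (?cl (const 1)) A = A"
    unfolding f(2) by (rule pi1_mult_class[OF const_sphere f(1) f(1) degen_square(2)[OF f(1)]])
  obtain g where g: "g \<in> sphere 1" "square X g (const 1) (const 1) f"
    using ex_left_inverse f by blast
  show "\<exists>B\<in>?cl ` sphere 1. pi1_mult (X, x) B A = ?cl (const 1)"
    using pi1_mult_class[OF g(1) f(1) const_sphere g(2)] g f by blast
  fix B assume "B \<in> ?cl ` sphere 1"
  then obtain g where g: "g \<in> sphere 1" "B = ?cl g" by blast
  obtain u where u: "u \<in> sphere 1" "square X f (const 1) u g" using ex_product f g by blast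
  note AB = pi1_mult_class[OF f(1) g(1) u, folded f(2) g(2)]
  show "pi1_mult (X, x) A B \<in> ?cl ` sphere 1" using AB u by blast
  fix C assume "C \<in> ?cl ` sphere 1"
  then obtain h where h: "h \<in> sphere 1" "C = ?cl h" by blast
  obtain v where v: "v \<in> sphere 1" "square X g (const 1) v h" using ex_product g h by blast
  obtain w where w: "w \<in> sphere 1" "square X u (const 1) w h" using ex_product u h by blast
  have "square X f (const 1) w v" by (rule square_assoc[OF u(2) v(2) w(2) h(1)])
  then show "pi1_mult (X, x) (pi1_mult (X, x) A B) C = pi1_mult (X, x) A (pi1_mult (X, x) B C)"
    using pi1_mult_class f g h u v w by simp
qed

end


section \<open>Commutativity\<close>

text \<open>With \<open>e\<close> the constant 2-cube, \<open>cube X e e f e h g\<close> exhibits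
  \<open>h\<close> as the product of \<open>f\<close> and \<open>g\<close> in the loop space, and
  \<open>cube X f e h g e e\<close> as their composite in direction 1.\<close>

definition cube :: "'a cubical_data \<Rightarrow> 'a \<Rightarrow> 'a \<Rightarrow> 'a \<Rightarrow> 'a \<Rightarrow> 'a \<Rightarrow> 'a \<Rightarrow> bool" where
  "cube X u v a b c d \<longleftrightarrow> (\<exists>s\<in>cells X 3.
     act X (face 3 1 False) s = u \<and> act X (face 3 1 True) s = v \<and>
     act X (face 3 2 False) s = a \<and> act X (face 3 2 True) s = b \<and>
     act X (face 3 3 False) s = c \<and> act X (face 3 3 True) s = d)"

lemma has_boundary_3:
  "has_boundary X 3 F j \<eta> y \<longleftrightarrow> y \<in> cells X 3 \<and> (\<forall>\<theta>.
     act X (face 3 1 \<theta>) y = (if 1 < j then F 1 j \<theta> \<eta> else F j 2 \<eta> \<theta>) \<and>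
     act X (face 3 2 \<theta>) y = (if 2 < j then F 2 j \<theta> \<eta> else F j 3 \<eta> \<theta>) \<and>
     act X (face 3 3 \<theta>) y = (if 3 < j then F 3 j \<theta> \<eta> else F j 4 \<eta> \<theta>))"
proof -
  have "{1..3::nat} = {1, 2, 3}" by auto
  then show ?thesis by (auto simp: has_boundary_def eval_nat_numeral)
qed

context pointed_kan_complex
begin

text \<open>Left unit laws for the two compositions.\<close>

lemma degen_cube:
  assumes a: "a \<in> sphere 2"
  shows "cube X (const 2) (const 2) a a (const 2) (const 2)"
    and "cube X (const 2) (const 2) (const 2) (const 2) a a"
proof -
  have cell: "act X (degen 3 i) a \<in> cells X 3" if "1 \<le> i" "i \<le> 3" for i
    using act_closed[OF box_hom_degen[of i 2] sphere_cell[OF a]] that by simp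
  have face: "act X (face 3 j \<epsilon>) (act X (degen 3 i) a) = (if j = i then a else const 2)"
    if "1 \<le> i" "i \<le> 3" "1 \<le> j" "j \<le> 3" for i j \<epsilon>
    using act_degen_sphere[of a 1 i j \<epsilon>] that a by (simp add: eval_nat_numeral)
  show "cube X (const 2) (const 2) a a (const 2) (const 2)" unfolding cube_def
    by (rule bexI[OF _ cell[of 2]]) (simp_all add: face)
  show "cube X (const 2) (const 2) (const 2) (const 2) a a" unfolding cube_def
    by (rule bexI[OF _ cell[of 3]]) (simp_all add: face)
qed

text \<open>Right unit laws for the two compositions.\<close>

lemma conn_cube:
  assumes a: "a \<in> sphere 2"
  shows "cube X a (const 2) a (const 2) (const 2) (const 2)"
    and "cube X (const 2) (const 2) a (const 2) a (const 2)"
proof -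
  have cell: "act X (conn 3 i False) a \<in> cells X 3" if "1 \<le> i" "i \<le> 2" for i
    using act_closed[OF box_hom_conn[of i 2] sphere_cell[OF a]] that by simp
  have face: "act X (face 3 j \<epsilon>) (act X (conn 3 i False) a)
      = (if (j = i \<or> j = Suc i) \<and> \<not> \<epsilon> then a else const 2)"
    if "1 \<le> i" "i \<le> 2" "1 \<le> j" "j \<le> 3" for i j \<epsilon>
    using act_conn_sphere[of a 1 i j \<epsilon>] that a by (simp add: eval_nat_numeral)
  show "cube X a (const 2) a (const 2) (const 2) (const 2)" unfolding cube_def
    by (rule bexI[OF _ cell[of 1]]) (simp_all add: face)
  show "cube X (const 2) (const 2) a (const 2) a (const 2)" unfolding cube_def
    by (rule bexI[OF _ cell[of 2]]) (simp_all add: face)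
qed

text \<open>In a 2 by 2 array with rows \<open>a c\<close> and \<open>b d\<close>, the columns have the composites \<open>u\<close>, \<open>v\<close> and the
  rows \<open>m\<close>, \<open>k\<close>. The 4-cube of the proof is formally a product of a square in the directions 1, 2
  with a square in the directions 3, 4; its face \<open>x\<^sub>2 = 0\<close> is the missing one.\<close>

lemma interchange:
  defines "e \<equiv> const 2"
  assumes "cube X e e a e u b" "cube X e e c e v d"
    and "cube X a e m c e e" "cube X b e k d e e" "cube X u e w v e e"
  shows "cube X e e m e w k"
proof -
  \<comment> \<open>The columns sit on the facets \<open>x\<^sub>1 = 0\<close> and
    \<open>x\<^sub>2 = 1\<close>, the rows on \<open>x\<^sub>3 = 0\<close> and
    \<open>x\<^sub>4 = 1\<close>, the composite of \<open>u\<close> and \<open>v\<close> on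
    \<open>x\<^sub>4 = 0\<close>; the facets \<open>x\<^sub>1 = 1\<close> and
    \<open>x\<^sub>3 = 1\<close> are constant.\<close>
  define F :: "nat \<Rightarrow> nat \<Rightarrow> bool \<Rightarrow> bool \<Rightarrow> 'a" where
    "F i j \<eta> \<theta> =
       (if i = 1 \<and> j = 3 then if \<eta> \<or> \<theta> then e else a
        else if i = 1 \<and> j = 4 then if \<eta> then e else if \<theta> then b else u
        else if i = 2 \<and> j = 3 then if \<theta> then e else if \<eta> then c else m
        else if i = 2 \<and> j = 4 then if \<eta> then if \<theta> then d else v else if \<theta> then k else w
        else e)" for i j \<eta> \<theta>
  have eeeeee: "cube X e e e e e e" unfolding e_def by (rule degen_cube(1)[OF const_sphere])
  have 3: "Suc 2 = 3" by simp
  have "\<exists>y. has_boundary X (Suc 2) F 2 False y"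
  proof (rule missing_face)
    fix j :: nat and \<eta> assume "1 \<le> j" "j \<le> Suc (Suc 2)" and ne: "(j, \<eta>) \<noteq> (2, False)"
    then consider "j = 1" "\<eta>" | "j = 1" "\<not> \<eta>" | "j = 2" "\<eta>" | "j = 3" "\<eta>" | "j = 3" "\<not> \<eta>"
      | "j = 4" "\<eta>" | "j = 4" "\<not> \<eta>" by fastforce
    then show "\<exists>y. has_boundary X (Suc 2) F j \<eta> y"
      unfolding 3 has_boundary_3
      by cases (use assms eeeeee in \<open>auto simp: all_bool_eq cube_def F_def\<close>)
  qed auto
  then show ?thesis
    unfolding cube_def 3 has_boundary_3 F_def by auto
qed

lemma ex_transverse_product:
  assumes "f \<in> sphere 2" "g \<in> sphere 2"
  shows "\<exists>w\<in>sphere 2. cube X f (const 2) w g (const 2) (const 2)"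
proof -
  let ?c = "\<lambda>j \<eta>. if j = 1 \<and> \<not> \<eta> then f else if j = 2 then g else const 2"
  have 2: "Suc 1 = 2" and 3: "Suc 2 = 3" by simp_all
  have "?c j \<eta> \<in> sphere (Suc 1)" for j \<eta> using assms unfolding 2 by simp
  then obtain y where y: "y \<in> cells X (Suc (Suc 1))"
    "\<And>j \<eta>. 1 \<le> j \<Longrightarrow> j \<le> Suc (Suc 1) \<Longrightarrow> (j, \<eta>) \<noteq> (2, False) \<Longrightarrow>
       act X (face (Suc (Suc 1)) j \<eta>) y = ?c j \<eta>"
    "act X (face (Suc (Suc 1)) 2 False) y \<in> sphere (Suc 1)"
    by (rule sphere_filling[of 2 1 False ?c, rotated 2]) simp_all
  note y = y[unfolded 2 3]
  show ?thesis
    unfolding cube_def by (rule bexI[OF _ y(3)], rule bexI[OF _ y(1)]) (simp add: y(2))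
qed

lemma fundamental_group_\<Omega>_commute:
  defines "P \<equiv> (\<Omega>, const 1)"
  assumes A: "A \<in> carrier (fundamental_group P)" and B: "B \<in> carrier (fundamental_group P)"
  shows "A \<otimes>\<^bsub>fundamental_group P\<^esub> B = B \<otimes>\<^bsub>fundamental_group P\<^esub> A"
proof -
  interpret L: pointed_kan_complex \<Omega> "const 1" by (rule pointed_kan_complex_\<Omega>)
  have const: "L.const k = const (Suc k)" for k
  proof -
    have "L.const k = act X (box_shift (box_terminal k)) (const 1)"
      unfolding L.const_def act_\<Omega> by (rule refl)
    then show ?thesis using act_const box_hom_shift[OF box_hom_terminal[of k]] by simp
  qed
  have sphere: "L.sphere 1 = sphere 2"
  proof -
    have 2: "{1..2::nat} = {1, 2}" and 1: "{1..1::nat} = {1}" by auto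
    have face: "act \<Omega> (face 1 1 \<epsilon>) c = act X (face 2 2 \<epsilon>) c" for \<epsilon> c
      using act_face_\<Omega>[of 1 0] by (simp add: numeral_2_eq_2)
    have "cells \<Omega> 1 = {c \<in> cells X 2. \<forall>\<epsilon>. act X (face 2 1 \<epsilon>) c = const 1}"
      using cells_\<Omega>[of 1] by (simp add: numeral_2_eq_2)
    then show ?thesis
      unfolding L.sphere_def sphere_def const 1 2 by (simp add: face[simplified] conj_assoc)
  qed
  \<comment> \<open>Directions 1 and 2 of \<open>\<Omega>\<close> are directions 2 and 3 of
    \<open>X\<close>; direction 1 of \<open>X\<close> carries the loop condition.\<close>
  have square: "square \<Omega> a (L.const 1) c d" if "cube X (const 2) (const 2) a (const 2) c d" for a c d
    unfolding const using that act_face_\<Omega>[of 1 1] act_face_\<Omega>[of 2 1]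
    by (auto simp: square_def cube_def cells_\<Omega> const all_bool_eq eval_nat_numeral)
  obtain f g where f: "f \<in> sphere 2" "A = pi0_class L.\<Omega> f" and g: "g \<in> sphere 2" "B = pi0_class L.\<Omega> g"
    using A B unfolding P_def L.fundamental_group_simps sphere by blast
  obtain w where w: "w \<in> sphere 2" "cube X f (const 2) w g (const 2) (const 2)"
    using ex_transverse_product f g by blast
  \<comment> \<open>Array with \<open>f\<close> and \<open>g\<close> on the main diagonal and
    constants elsewhere.\<close>
  have "cube X (const 2) (const 2) f (const 2) w g"
    by (rule interchange[OF conn_cube(2)[OF f(1)] degen_cube(2)[OF g(1)] conn_cube(1)[OF f(1)]
          degen_cube(1)[OF g(1)] w(2)])
  \<comment> \<open>Array with \<open>g\<close> top right and \<open>f\<close> bottom left: the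
    columns still compose to \<open>f\<close> and \<open>g\<close>, so the same \<open>w\<close>
    serves, but the rows are now \<open>g\<close> and \<open>f\<close>.\<close>
  moreover have "cube X (const 2) (const 2) g (const 2) w f"
    by (rule interchange[OF degen_cube(2)[OF f(1)] conn_cube(2)[OF g(1)] degen_cube(1)[OF g(1)]
          conn_cube(1)[OF f(1)] w(2)])
  ultimately show ?thesis
    unfolding P_def f(2) g(2) L.fundamental_group_simps(2) using L.pi1_mult_class sphere square f(1) g(1) w(1) by metis
qed

end

section \<open>Iterated loop spaces\<close>

lemma pointed_kan_complex_loops:
  assumes "pointed_kan_complex X x"
  shows "\<exists>Y y. (loops ^^ k) (X, x) = (Y, y) \<and> pointed_kan_complex Y y"
proof (induction k)
  case 0 show ?case using assms by simp
next
  case (Suc k)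
  then obtain Y y where Y: "(loops ^^ k) (X, x) = (Y, y)" "pointed_kan_complex Y y" by blast
  then show ?case
    using pointed_kan_complex.loops_eq[OF Y(2)] pointed_kan_complex.pointed_kan_complex_\<Omega>[OF Y(2)]
    by simp
qed

theorem corollary4p3:
  fixes X :: "'a cubical_data" and x :: 'a and n :: nat
  assumes "kan_complex X" and "x \<in> cells X 0" and "n \<ge> 2"
  shows "comm_group (homotopy_group n (X, x))"
proof -
  have "pointed_kan_complex X x"
    using assms(1,2) by (simp add: pointed_kan_complex_def pointed_kan_complex_axioms_def)
  \<comment> \<open>The group is the fundamental group of the \<open>(n - 1)\<close>-fold loop
    space; stopping one step earlier presents that space as the loop space of
    \<open>Y\<close>.\<close>
  from pointed_kan_complex_loops[OF this, of "n - 2"] obtain Y y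
    where Y: "(loops ^^ (n - 2)) (X, x) = (Y, y)" "pointed_kan_complex Y y" by blast
  interpret Y: pointed_kan_complex Y y by fact
  interpret L: pointed_kan_complex Y.\<Omega> "Y.const 1" by (rule Y.pointed_kan_complex_\<Omega>)
  have "n - 1 = Suc (n - 2)" using assms(3) by simp
  then have "homotopy_group n (X, x) = fundamental_group (Y.\<Omega>, Y.const 1)"
    unfolding homotopy_group_def using Y(1) Y.loops_eq by simp
  moreover have "comm_group (fundamental_group (Y.\<Omega>, Y.const 1))"
    by (rule group.group_comm_groupI[OF L.group_fundamental_group Y.fundamental_group_\<Omega>_commute])
  ultimately show ?thesis by (rule ssubst)
qed

end
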